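(* Let $H$ be a Hopf algebra over $k=\mathbb R$ or $\mathbb C$ with a differential structure for which the coproduct is differentiable, and let $M$ be a left $H$-comodule algebra with a differential structure for which the left coaction $\lambda:M\to H\otimes M$ is differentiable. For $\alpha\in\mathfrak h$, let $\Lambda(\alpha)=(\alpha\otimes\mathrm{id})\Pi_1\lambda_*\in\mathrm{Vec}\,M$ be the vector field on $M$ generated by $\alpha$, and let $\exp(\alpha)\in H^*$ be the exponential of $\alpha$. Then $$\exp(\mathcal L_{\Lambda(\alpha)})=(\exp(\alpha)\otimes\mathrm{id})\circ\lambda:M\to M.$$
   Context: All algebras are unital and associative. A differential structure on an algebra $B$ is a graded algebra $\Omega^nB$, $n\ge0$, with $\Omega^0B=B$ and a linear map $d$ of degree $1$ with $d^2=0$ satisfying the graded Leibniz rule, such that $\Omega^{n+1}B$ is spanned by $B.d\Omega^nB$ and also by $d\Omega^nB.B$. An algebra map $f:B\to C$ between algebras with differential structures is differentiable if $f_*:\Omega^1B\to\Omega^1C$, $f_*(b\,db')=f(b)\,df(b')$, is well defined. The tensor product differential structure on $B\otimes C$ has $\Omega^1(B\otimes C)=(\Omega^1B\otimes C)\oplus(B\otimes\Omega^1C)$ with $d(b\otimes c)=db\otimes c+b\otimes dc$; $\Pi_1,\Pi_2$ denote the projections to the two summands. $H\otimes H$ and $H\otimes M$ carry this structure. The braided Lie algebra of $H$ is $\mathfrak h=\{\alpha:\Omega^1H\to k\ \text{linear}:\ \alpha(\xi.h)=\alpha(\xi)\,\epsilon(h)\ \ \forall h\in H,\ \xi\in\Omega^1H\}$,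 with $\epsilon$ the counit. A vector field on an algebra $B$ is a right $B$-module map $\Omega^1B\to B$; $\mathrm{Vec}\,M$ is the set of vector fields on $M$. On $\Omega^0B=B$ the Lie derivative is $\mathcal L_X(b)=X(db)$, and $\exp(\mathcal L_X)=\sum_{r\ge0}\frac1{r!}(\mathcal L_X)^r$. $M$ is a left $H$-comodule algebra if it is a left $H$-comodule via $\lambda$ and $\lambda:M\to H\otimes M$ is a unital algebra map. For $\alpha\in\mathfrak h$ let $L_\alpha=(\mathrm{id}\otimes\alpha)\Pi_2\Delta_*:\Omega^1H\to H$, a vector field on $H$. The exponential $\exp(\alpha)\in H^*$ (linear dual) is defined by $\exp(\alpha)(h)=\epsilon\big(\exp(\mathcal L_{L_\alpha})(h)\big)$, i.e. $$\exp(\alpha)(h)=\sum_{r\ge0}\frac1{r!}\,\alpha(dh_{(1)})\cdots\alpha(dh_{(r)}),$$ where $h_{(1)}\otimes\cdots\otimes h_{(r)}$ is the iterated coproduct (Sweedler notation) and the $r=0$ term is $\epsilon(h)$. For the vector fields $L_\alpha$ and $\Lambda(\alpha)$ the terms of the exponential series applied to a fixed element lie in a finite-dimensional subspace, and convergence is in the usual topology of that subspace. *)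

theory Defs
  imports Complex_Main "HOL-Library.Function_Algebras" "HOL-Library.Product_Plus"
begin

text \<open>
  Vector spaces are whole types equipped with a scalar multiplication satisfying
  \<^locale>\<open>vector_space\<close>; subspaces and direct sums of subspaces live inside such types.
  Algebras are only required to be rings with unit; in particular the zero algebra is allowed.
\<close>

definition linear_on :: "('k::field \<Rightarrow> 'a::ab_group_add \<Rightarrow> 'a) \<Rightarrow> ('k \<Rightarrow> 'b::ab_group_add \<Rightarrow> 'b)
    \<Rightarrow> 'a set \<Rightarrow> ('a \<Rightarrow> 'b) \<Rightarrow> bool"
  where "linear_on s1 s2 A f \<longleftrightarrow>
    (\<forall>x\<in>A. \<forall>y\<in>A. f (x + y) = f x + f y) \<and> (\<forall>c. \<forall>x\<in>A. f (s1 c x) = s2 c (f x))"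

definition bilinear_on :: "('k::field \<Rightarrow> 'a::ab_group_add \<Rightarrow> 'a) \<Rightarrow> ('k \<Rightarrow> 'b::ab_group_add \<Rightarrow> 'b)
    \<Rightarrow> ('k \<Rightarrow> 'c::ab_group_add \<Rightarrow> 'c) \<Rightarrow> 'a set \<Rightarrow> 'b set \<Rightarrow> ('a \<Rightarrow> 'b \<Rightarrow> 'c) \<Rightarrow> bool"
  where "bilinear_on s1 s2 s3 A B f \<longleftrightarrow>
    (\<forall>a\<in>A. linear_on s2 s3 B (f a)) \<and> (\<forall>b\<in>B. linear_on s1 s3 A (\<lambda>a. f a b))"

definition unital_algebra :: "('k::field \<Rightarrow> 'a::{ring,monoid_mult} \<Rightarrow> 'a) \<Rightarrow> bool"
  where "unital_algebra s \<longleftrightarrow> vector_space s \<and>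
    (\<forall>c x y. s c (x * y) = s c x * y \<and> s c (x * y) = x * s c y)"


section \<open>Algebraic tensor products\<close>

text \<open>
  The tensor product of vector spaces \<open>V\<close> and \<open>W\<close> is realised inside the dual of the space of
  bilinear forms on \<open>V \<times> W\<close>: the pure tensor of \<open>v\<close> and \<open>w\<close> is evaluation of bilinear forms at
  \<open>(v, w)\<close>, and for subspaces \<open>A \<subseteq> V\<close>, \<open>B \<subseteq> W\<close> the space \<open>A \<otimes> B\<close> is the span of the pure tensors
  with legs in \<open>A\<close> and \<open>B\<close>.  Over a field this is the algebraic tensor product; the universal
  property is \<open>tensor_universal\<close> and \<open>tensor_unique\<close> below.
\<close>

type_synonym ('k, 'v, 'w) tensor = "('v \<Rightarrow> 'w \<Rightarrow> 'k) \<Rightarrow> 'k"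

definition tscale :: "'k::field \<Rightarrow> ('k, 'v, 'w) tensor \<Rightarrow> ('k, 'v, 'w) tensor"
  where "tscale c t = (\<lambda>\<beta>. c * t \<beta>)"

definition pure_tensor :: "('k::field \<Rightarrow> 'v::ab_group_add \<Rightarrow> 'v) \<Rightarrow> ('k \<Rightarrow> 'w::ab_group_add \<Rightarrow> 'w)
    \<Rightarrow> 'v \<Rightarrow> 'w \<Rightarrow> ('k, 'v, 'w) tensor"
  where "pure_tensor s1 s2 v w = (\<lambda>\<beta>. if bilinear_on s1 s2 (*) UNIV UNIV \<beta> then \<beta> v w else 0)"

definition tensor_space :: "('k::field \<Rightarrow> 'v::ab_group_add \<Rightarrow> 'v) \<Rightarrow> ('k \<Rightarrow> 'w::ab_group_add \<Rightarrow> 'w)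
    \<Rightarrow> 'v set \<Rightarrow> 'w set \<Rightarrow> ('k, 'v, 'w) tensor set"
  where "tensor_space s1 s2 A B = module.span tscale {pure_tensor s1 s2 a b |a b. a \<in> A \<and> b \<in> B}"

text \<open>The linear map on \<open>A \<otimes> B\<close> induced by a bilinear map on \<open>A \<times> B\<close>; only its values on
  \<^term>\<open>tensor_space s1 s2 A B\<close> are meaningful.\<close>

definition tensor_lift :: "('k::field \<Rightarrow> 'v::ab_group_add \<Rightarrow> 'v) \<Rightarrow> ('k \<Rightarrow> 'w::ab_group_add \<Rightarrow> 'w)
    \<Rightarrow> ('k \<Rightarrow> 'z::ab_group_add \<Rightarrow> 'z) \<Rightarrow> 'v set \<Rightarrow> 'w set \<Rightarrow> ('v \<Rightarrow> 'w \<Rightarrow> 'z)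
    \<Rightarrow> ('k, 'v, 'w) tensor \<Rightarrow> 'z"
  where "tensor_lift s1 s2 s3 A B f =
    (SOME g. linear_on tscale s3 (tensor_space s1 s2 A B) g \<and>
             (\<forall>a\<in>A. \<forall>b\<in>B. g (pure_tensor s1 s2 a b) = f a b))"

lemma linear_onD:
  assumes "linear_on s1 s2 A f"
  shows "x \<in> A \<Longrightarrow> y \<in> A \<Longrightarrow> f (x + y) = f x + f y" "x \<in> A \<Longrightarrow> f (s1 c x) = s2 c (f x)"
  using assms by (auto simp: linear_on_def)

lemma linear_on_UNIV:
  assumes "vector_space s1" "vector_space s2"
  shows "linear_on s1 s2 UNIV f \<longleftrightarrow> Vector_Spaces.linear s1 s2 f"
  using assms
  by (auto simp: linear_on_def Vector_Spaces.linear_iff vector_space_pair_def)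

lemma vector_space_tscale: "vector_space (tscale :: 'k::field \<Rightarrow> ('k, 'v, 'w) tensor \<Rightarrow> _)"
  by unfold_locales (auto simp: tscale_def fun_eq_iff algebra_simps)

lemma vector_space_field: "vector_space ((*) :: 'k::field \<Rightarrow> 'k \<Rightarrow> 'k)"
  by unfold_locales (auto simp: algebra_simps)

lemma bilinear_on_pure: "bilinear_on s1 s2 tscale UNIV UNIV (pure_tensor s1 s2)"
  by (auto simp: bilinear_on_def linear_on_def pure_tensor_def tscale_def fun_eq_iff)

lemma pure_in_tensor_space:
  fixes s1 :: "'k::field \<Rightarrow> 'v::ab_group_add \<Rightarrow> 'v" and s2 :: "'k \<Rightarrow> 'w::ab_group_add \<Rightarrow> 'w"
  assumes "a \<in> A" "b \<in> B"
  shows "pure_tensor s1 s2 a b \<in> tensor_space s1 s2 A B"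
proof -
  interpret T: vector_space "tscale :: 'k \<Rightarrow> ('k, 'v, 'w) tensor \<Rightarrow> _"
    by (rule vector_space_tscale)
  show ?thesis unfolding tensor_space_def using assms by (intro T.span_base) blast
qed

lemma tensor_unique:
  fixes s1 :: "'k::field \<Rightarrow> 'v::ab_group_add \<Rightarrow> 'v" and s2 :: "'k \<Rightarrow> 'w::ab_group_add \<Rightarrow> 'w"
    and s3 :: "'k \<Rightarrow> 'z::ab_group_add \<Rightarrow> 'z"
  assumes s3: "vector_space s3"
    and g: "linear_on tscale s3 (tensor_space s1 s2 A B) g"
    and h: "linear_on tscale s3 (tensor_space s1 s2 A B) h"
    and eq: "\<And>a b. a \<in> A \<Longrightarrow> b \<in> B \<Longrightarrow> g (pure_tensor s1 s2 a b) = h (pure_tensor s1 s2 a b)"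
    and t: "t \<in> tensor_space s1 s2 A B"
  shows "g t = h t"
proof -
  interpret T: vector_space "tscale :: 'k \<Rightarrow> ('k, 'v, 'w) tensor \<Rightarrow> _"
    by (rule vector_space_tscale)
  interpret Z: vector_space s3 by (rule s3)
  let ?P = "{pure_tensor s1 s2 a b |a b. a \<in> A \<and> b \<in> B}"
  have "t \<in> T.span ?P \<and> g t = h t"
  proof (rule T.span_induct_alt[where h = "\<lambda>t. t \<in> T.span ?P \<and> g t = h t" and S = ?P])
    have "g (tscale 0 0) = s3 0 (g 0)" "h (tscale 0 0) = s3 0 (h 0)"
      using linear_onD(2)[OF g, of 0 0] linear_onD(2)[OF h, of 0 0] T.span_zero
      by (auto simp: tensor_space_def)
    then show "0 \<in> T.span ?P \<and> g 0 = h 0"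
      by (simp add: T.span_zero)
  next
    fix c x y
    assume x: "x \<in> ?P" and y: "y \<in> T.span ?P \<and> g y = h y"
    have xs: "x \<in> T.span ?P" using x by (rule T.span_base)
    then have cx: "tscale c x \<in> T.span ?P" by (rule T.span_scale)
    have "g x = h x" using x eq by auto
    moreover have "g (tscale c x + y) = s3 c (g x) + g y" "h (tscale c x + y) = s3 c (h x) + h y"
      using xs cx y linear_onD[OF g] linear_onD[OF h]
      by (simp_all add: tensor_space_def)
    moreover have "tscale c x + y \<in> T.span ?P" using cx y T.span_add by blast
    ultimately show "tscale c x + y \<in> T.span ?P \<and> g (tscale c x + y) = h (tscale c x + y)"
      using y by simp
  qed (use t in \<open>simp add: tensor_space_def\<close>)
  then show ?thesis by simp
qed

lemma functionals_separate:
  assumes "vector_space s" and eq: "\<And>\<phi>. Vector_Spaces.linear s (*) \<phi> \<Longrightarrow> \<phi> x = \<phi> y"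
  shows "x = y"
proof (rule ccontr)
  assume "x \<noteq> y"
  interpret vector_space_pair s "(*)"
    using assms(1) vector_space_field by (simp add: vector_space_pair_def)
  have "vs1.independent {x - y}" using \<open>x \<noteq> y\<close> by (simp only: vs1.dependent_single) simp
  from linear_independent_extend[OF this, of "\<lambda>_. 1"]
  obtain \<phi> where \<phi>: "Vector_Spaces.linear s (*) \<phi>" "\<phi> (x - y) = 1" by auto
  with eq[OF \<phi>(1)] linear_diff[OF \<phi>(1), of x y] show False by simp
qed

lemma tensor_universal_UNIV:
  fixes s1 :: "'k::field \<Rightarrow> 'v::ab_group_add \<Rightarrow> 'v" and s2 :: "'k \<Rightarrow> 'w::ab_group_add \<Rightarrow> 'w"
    and s3 :: "'k \<Rightarrow> 'z::ab_group_add \<Rightarrow> 'z"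
  assumes s3: "vector_space s3" and f: "bilinear_on s1 s2 s3 UNIV UNIV f"
  obtains g where "Vector_Spaces.linear tscale s3 g" "\<And>a b. g (pure_tensor s1 s2 a b) = f a b"
proof -
  interpret TZ: vector_space_pair "tscale :: 'k \<Rightarrow> ('k, 'v, 'w) tensor \<Rightarrow> _" s3
    using s3 vector_space_tscale by (simp add: vector_space_pair_def)
  interpret Tk: vector_space_pair "tscale :: 'k \<Rightarrow> ('k, 'v, 'w) tensor \<Rightarrow> _" "(*) :: 'k \<Rightarrow> _"
    using vector_space_field vector_space_tscale by (simp add: vector_space_pair_def)
  let ?P = "{pure_tensor s1 s2 a b |a b. True}"
  obtain C where C: "C \<subseteq> ?P" "TZ.vs1.independent C" "?P \<subseteq> TZ.vs1.span C"
    by (rule TZ.vs1.maximal_independent_subset)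
  define q where "q c = (SOME p. c = pure_tensor s1 s2 (fst p) (snd p))" for c
  have q: "c = pure_tensor s1 s2 (fst (q c)) (snd (q c))" if "c \<in> C" for c
  proof -
    from that C(1) have "\<exists>p. c = pure_tensor s1 s2 (fst p) (snd p)" by fastforce
    then show ?thesis unfolding q_def by (rule someI_ex)
  qed
  from TZ.linear_independent_extend[OF C(2), of "\<lambda>c. f (fst (q c)) (snd (q c))"]
  obtain g where g: "Vector_Spaces.linear tscale s3 g"
    and gC: "\<And>c. c \<in> C \<Longrightarrow> g c = f (fst (q c)) (snd (q c))" by auto
  have "g (pure_tensor s1 s2 a b) = f a b" for a b
  proof (rule functionals_separate[OF s3])
    fix \<phi> assume \<phi>: "Vector_Spaces.linear s3 (*) \<phi>"
    define \<beta> where "\<beta> = (\<lambda>a b. \<phi> (f a b))"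
    have \<phi>': "\<phi> (x + y) = \<phi> x + \<phi> y" "\<phi> (s3 c x) = c * \<phi> x" for x y c
      using \<phi> by (auto simp: Vector_Spaces.linear_iff)
    have \<beta>: "bilinear_on s1 s2 (*) UNIV UNIV \<beta>"
      using f by (auto simp: bilinear_on_def linear_on_def \<beta>_def \<phi>')
    have ev: "Vector_Spaces.linear tscale (*) (\<lambda>t :: ('k, 'v, 'w) tensor. t \<beta>)"
      by (auto simp: Vector_Spaces.linear_iff tscale_def vector_space_field
          vector_space_tscale Tk.vector_space_pair_axioms)
    have \<phi>g: "Vector_Spaces.linear tscale (*) (\<lambda>t :: ('k, 'v, 'w) tensor. \<phi> (g t))"
      using g \<phi> by (auto simp: Vector_Spaces.linear_iff)
    have "pure_tensor s1 s2 a b \<in> TZ.vs1.span C" using C(3) by auto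
    then have "\<phi> (g (pure_tensor s1 s2 a b)) = pure_tensor s1 s2 a b \<beta>"
    proof (rule Tk.linear_eq_on[OF \<phi>g ev])
      fix c assume c: "c \<in> C"
      have "c \<beta> = \<beta> (fst (q c)) (snd (q c))"
        using q[OF c] \<beta> by (metis (full_types) pure_tensor_def)
      then show "\<phi> (g c) = c \<beta>" by (simp add: gC[OF c] \<beta>_def)
    qed
    then show "\<phi> (g (pure_tensor s1 s2 a b)) = \<phi> (f a b)"
      using \<beta> by (simp add: pure_tensor_def \<beta>_def)
  qed
  with g that show thesis by blast
qed

lemma subspace_projection:
  assumes "vector_space s" "module.subspace s A"
  obtains p where "Vector_Spaces.linear s s p" "range p \<subseteq> A" "\<And>a. a \<in> A \<Longrightarrow> p a = a"
proof -
  interpret vector_space_pair s s using assms(1) by (simp add: vector_space_pair_def)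
  have "Vector_Spaces.linear s s (\<lambda>x. x)" by (simp add: vs1.linear_ident)
  from linear_exists_left_inverse_on[OF this assms(2)] that show thesis by auto
qed

lemma tensor_universal:
  fixes s1 :: "'k::field \<Rightarrow> 'v::ab_group_add \<Rightarrow> 'v" and s2 :: "'k \<Rightarrow> 'w::ab_group_add \<Rightarrow> 'w"
    and s3 :: "'k \<Rightarrow> 'z::ab_group_add \<Rightarrow> 'z"
  assumes "vector_space s1" "vector_space s2" "vector_space s3"
    and "module.subspace s1 A" "module.subspace s2 B"
    and f: "bilinear_on s1 s2 s3 A B f"
  shows "linear_on tscale s3 (tensor_space s1 s2 A B) (tensor_lift s1 s2 s3 A B f)"
    and "a \<in> A \<Longrightarrow> b \<in> B \<Longrightarrow> tensor_lift s1 s2 s3 A B f (pure_tensor s1 s2 a b) = f a b"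
proof -
  from assms obtain p where p: "Vector_Spaces.linear s1 s1 p" "range p \<subseteq> A"
    "\<And>a. a \<in> A \<Longrightarrow> p a = a" using subspace_projection by blast
  from assms obtain r where r: "Vector_Spaces.linear s2 s2 r" "range r \<subseteq> B"
    "\<And>b. b \<in> B \<Longrightarrow> r b = b" using subspace_projection by blast
  have "p x \<in> A" "r y \<in> B" for x y using p(2) r(2) by auto
  then have "bilinear_on s1 s2 s3 UNIV UNIV (\<lambda>x y. f (p x) (r y))"
    using f p(1) r(1) by (auto simp: bilinear_on_def linear_on_def Vector_Spaces.linear_iff)
  from tensor_universal_UNIV[OF assms(3) this]
  obtain g where g: "Vector_Spaces.linear tscale s3 g"
      "\<And>a b. g (pure_tensor s1 s2 a b) = f (p a) (r b)" by blast
  then have "linear_on tscale s3 (tensor_space s1 s2 A B) g \<and>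
      (\<forall>a\<in>A. \<forall>b\<in>B. g (pure_tensor s1 s2 a b) = f a b)"
    using p(3) r(3) by (auto simp: linear_on_def Vector_Spaces.linear_iff)
  then have *: "linear_on tscale s3 (tensor_space s1 s2 A B) (tensor_lift s1 s2 s3 A B f) \<and>
      (\<forall>a\<in>A. \<forall>b\<in>B. tensor_lift s1 s2 s3 A B f (pure_tensor s1 s2 a b) = f a b)"
    unfolding tensor_lift_def
    by (rule someI[where P = "\<lambda>g. linear_on tscale s3 (tensor_space s1 s2 A B) g \<and>
      (\<forall>a\<in>A. \<forall>b\<in>B. g (pure_tensor s1 s2 a b) = f a b)"])
  then show "linear_on tscale s3 (tensor_space s1 s2 A B) (tensor_lift s1 s2 s3 A B f)"
    "a \<in> A \<Longrightarrow> b \<in> B \<Longrightarrow> tensor_lift s1 s2 s3 A B f (pure_tensor s1 s2 a b) = f a b" by auto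
qed

definition tensor_mult :: "('k::field \<Rightarrow> 'a::{ring,monoid_mult} \<Rightarrow> 'a)
    \<Rightarrow> ('k \<Rightarrow> 'b::{ring,monoid_mult} \<Rightarrow> 'b)
    \<Rightarrow> ('k, 'a, 'b) tensor \<Rightarrow> ('k, 'a, 'b) tensor \<Rightarrow> ('k, 'a, 'b) tensor"
  where "tensor_mult s1 s2 t u =
    tensor_lift s1 s2 tscale UNIV UNIV (\<lambda>a b.
      tensor_lift s1 s2 tscale UNIV UNIV (\<lambda>c d. pure_tensor s1 s2 (a * c) (b * d)) u) t"

text \<open>The associator \<open>(U \<otimes> V) \<otimes> W \<rightarrow> U \<otimes> (V \<otimes> W)\<close>.\<close>

definition tensor_assoc :: "('k::field \<Rightarrow> 'u::ab_group_add \<Rightarrow> 'u) \<Rightarrow> ('k \<Rightarrow> 'v::ab_group_add \<Rightarrow> 'v)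
    \<Rightarrow> ('k \<Rightarrow> 'w::ab_group_add \<Rightarrow> 'w) \<Rightarrow> ('k, ('k, 'u, 'v) tensor, 'w) tensor
    \<Rightarrow> ('k, 'u, ('k, 'v, 'w) tensor) tensor"
  where "tensor_assoc s1 s2 s3 =
    tensor_lift tscale s3 tscale (tensor_space s1 s2 UNIV UNIV) UNIV (\<lambda>t w.
      tensor_lift s1 s2 tscale UNIV UNIV (\<lambda>u v. pure_tensor s1 tscale u (pure_tensor s2 s3 v w)) t)"

definition algebra_map_to_tensor :: "('k::field \<Rightarrow> 'a::{ring,monoid_mult} \<Rightarrow> 'a)
    \<Rightarrow> ('k \<Rightarrow> 'b::{ring,monoid_mult} \<Rightarrow> 'b) \<Rightarrow> ('k \<Rightarrow> 'c::{ring,monoid_mult} \<Rightarrow> 'c)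
    \<Rightarrow> ('a \<Rightarrow> ('k, 'b, 'c) tensor) \<Rightarrow> bool"
  where "algebra_map_to_tensor s s1 s2 f \<longleftrightarrow>
    range f \<subseteq> tensor_space s1 s2 UNIV UNIV \<and> linear_on s tscale UNIV f \<and>
    f 1 = pure_tensor s1 s2 1 1 \<and> (\<forall>x y. f (x * y) = tensor_mult s1 s2 (f x) (f y))"


section \<open>Hopf algebras and comodule algebras\<close>

definition hopf_algebra :: "('k::field \<Rightarrow> 'h::{ring,monoid_mult} \<Rightarrow> 'h)
    \<Rightarrow> ('h \<Rightarrow> ('k, 'h, 'h) tensor) \<Rightarrow> ('h \<Rightarrow> 'k) \<Rightarrow> ('h \<Rightarrow> 'h) \<Rightarrow> bool"
  where "hopf_algebra s \<Delta> \<epsilon> S \<longleftrightarrow>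
    unital_algebra s \<and>
    algebra_map_to_tensor s s s \<Delta> \<and>
    linear_on s (*) UNIV \<epsilon> \<and> \<epsilon> 1 = 1 \<and> (\<forall>x y. \<epsilon> (x * y) = \<epsilon> x * \<epsilon> y) \<and>
    (\<forall>h. tensor_assoc s s s (tensor_lift s s tscale UNIV UNIV (\<lambda>a b. pure_tensor tscale s (\<Delta> a) b) (\<Delta> h))
         = tensor_lift s s tscale UNIV UNIV (\<lambda>a b. pure_tensor s tscale a (\<Delta> b)) (\<Delta> h)) \<and>
    (\<forall>h. tensor_lift s s s UNIV UNIV (\<lambda>a b. s (\<epsilon> a) b) (\<Delta> h) = h) \<and>
    (\<forall>h. tensor_lift s s s UNIV UNIV (\<lambda>a b. s (\<epsilon> b) a) (\<Delta> h) = h) \<and>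
    linear_on s s UNIV S \<and>
    (\<forall>h. tensor_lift s s s UNIV UNIV (\<lambda>a b. S a * b) (\<Delta> h) = s (\<epsilon> h) 1) \<and>
    (\<forall>h. tensor_lift s s s UNIV UNIV (\<lambda>a b. a * S b) (\<Delta> h) = s (\<epsilon> h) 1)"

definition left_comodule_algebra :: "('k::field \<Rightarrow> 'h::{ring,monoid_mult} \<Rightarrow> 'h)
    \<Rightarrow> ('h \<Rightarrow> ('k, 'h, 'h) tensor) \<Rightarrow> ('h \<Rightarrow> 'k) \<Rightarrow> ('k \<Rightarrow> 'm::{ring,monoid_mult} \<Rightarrow> 'm)
    \<Rightarrow> ('m \<Rightarrow> ('k, 'h, 'm) tensor) \<Rightarrow> bool"
  where "left_comodule_algebra s \<Delta> \<epsilon> sM \<rho> \<longleftrightarrow>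
    unital_algebra sM \<and>
    algebra_map_to_tensor sM s sM \<rho> \<and>
    (\<forall>m. tensor_assoc s s sM (tensor_lift s sM tscale UNIV UNIV (\<lambda>h n. pure_tensor tscale sM (\<Delta> h) n) (\<rho> m))
         = tensor_lift s sM tscale UNIV UNIV (\<lambda>h n. pure_tensor s tscale h (\<rho> n)) (\<rho> m)) \<and>
    (\<forall>m. tensor_lift s sM sM UNIV UNIV (\<lambda>h n. sM (\<epsilon> h) n) (\<rho> m) = m)"


section \<open>Differential structures\<close>

text \<open>
  An algebra \<open>B\<close> (with scalar multiplication \<open>scal\<close>) together with a graded algebra of forms.
  The type \<open>'w\<close> is the total algebra, the direct sum of the spaces \<open>forms n\<close>, and \<open>emb\<close> is the
  identification of \<open>B\<close> with the forms of degree \<open>0\<close>.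
\<close>

record ('k, 'b, 'w) diff_algebra =
  scal :: "'k \<Rightarrow> 'b \<Rightarrow> 'b"
  fscal :: "'k \<Rightarrow> 'w \<Rightarrow> 'w"
  emb :: "'b \<Rightarrow> 'w"
  forms :: "nat \<Rightarrow> 'w set"
  diff :: "'w \<Rightarrow> 'w"

definition differential_structure ::
    "('k::field, 'b::{ring,monoid_mult}, 'w::{ring,monoid_mult}) diff_algebra \<Rightarrow> bool"
  where "differential_structure B \<longleftrightarrow>
    unital_algebra (scal B) \<and> unital_algebra (fscal B) \<and>
    (\<forall>n. module.subspace (fscal B) (forms B n)) \<and>
    (\<forall>w. \<exists>!f. (\<forall>n. f n \<in> forms B n) \<and> finite {n. f n \<noteq> 0} \<and> w = (\<Sum>n | f n \<noteq> 0. f n)) \<and>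
    (\<forall>m n. \<forall>x\<in>forms B m. \<forall>y\<in>forms B n. x * y \<in> forms B (m + n)) \<and>
    linear_on (scal B) (fscal B) UNIV (emb B) \<and> emb B 1 = 1 \<and>
    (\<forall>a b. emb B (a * b) = emb B a * emb B b) \<and> bij_betw (emb B) UNIV (forms B 0) \<and>
    linear_on (fscal B) (fscal B) UNIV (diff B) \<and>
    (\<forall>n. \<forall>x\<in>forms B n. diff B x \<in> forms B (Suc n)) \<and>
    (\<forall>x. diff B (diff B x) = 0) \<and>
    (\<forall>n. \<forall>x\<in>forms B n. \<forall>y. diff B (x * y) = diff B x * y + (- 1) ^ n * x * diff B y) \<and>
    (\<forall>n. forms B (Suc n) = module.span (fscal B) {emb B b * diff B x |b x. x \<in> forms B n}) \<and>
    (\<forall>n. forms B (Suc n) = module.span (fscal B) {diff B x * emb B b |b x. x \<in> forms B n})"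

definition vector_field ::
    "('k::field, 'b::{ring,monoid_mult}, 'w::{ring,monoid_mult}) diff_algebra \<Rightarrow> ('w \<Rightarrow> 'b) \<Rightarrow> bool"
  where "vector_field B X \<longleftrightarrow> linear_on (fscal B) (scal B) (forms B 1) X \<and>
    (\<forall>\<xi>\<in>forms B 1. \<forall>b. X (\<xi> * emb B b) = X \<xi> * b)"

definition lie_derivative ::
    "('k, 'b, 'w) diff_algebra \<Rightarrow> ('w \<Rightarrow> 'b) \<Rightarrow> 'b \<Rightarrow> 'b"
  where "lie_derivative B X b = X (diff B (emb B b))"

text \<open>
  The map \<open>f\<^sub>*\<close> on one-forms for \<open>f : B \<rightarrow> C\<close>.  The target only enters through its one-forms, given by
  their scalar multiplication \<open>sX\<close>, the left action \<open>act\<close> of \<open>C\<close> and the derivative \<open>\<delta> : C \<rightarrow> \<Omega>\<^sup>1C\<close>.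
  As the one-forms of \<open>B\<close> are spanned by the \<open>b db'\<close>, the formula for \<open>f\<^sub>*\<close> is well defined iff
  such a linear map exists, and the map is then unique on \<^term>\<open>forms B 1\<close>.
\<close>

definition is_pushforward ::
    "('k::field, 'b, 'w::{ring,monoid_mult}) diff_algebra \<Rightarrow> ('k \<Rightarrow> 'x::ab_group_add \<Rightarrow> 'x)
      \<Rightarrow> ('c \<Rightarrow> 'x \<Rightarrow> 'x) \<Rightarrow> ('c \<Rightarrow> 'x) \<Rightarrow> ('b \<Rightarrow> 'c) \<Rightarrow> ('w \<Rightarrow> 'x) \<Rightarrow> bool"
  where "is_pushforward B sX act \<delta> f g \<longleftrightarrow>
    linear_on (fscal B) sX (forms B 1) g \<and>
    (\<forall>b b'. g (emb B b * diff B (emb B b')) = act (f b) (\<delta> (f b')))"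

text \<open>
  One-forms of the tensor product differential structure: pairs in
  \<open>(\<Omega>\<^sup>1B \<otimes> C) \<oplus> (B \<otimes> \<Omega>\<^sup>1C)\<close>, so that \<open>\<Pi>\<^sub>1\<close>, \<open>\<Pi>\<^sub>2\<close> are \<^const>\<open>fst\<close>, \<^const>\<open>snd\<close>.
\<close>

type_synonym ('k, 'b, 'wb, 'c, 'wc) tensor_forms = "('k, 'wb, 'c) tensor \<times> ('k, 'b, 'wc) tensor"

definition tensor_forms_scale :: "'k::field \<Rightarrow> ('k, 'b, 'wb, 'c, 'wc) tensor_forms
    \<Rightarrow> ('k, 'b, 'wb, 'c, 'wc) tensor_forms"
  where "tensor_forms_scale c = map_prod (tscale c) (tscale c)"

definition tensor_diff ::
    "('k::field, 'b::{ring,monoid_mult}, 'wb::{ring,monoid_mult}) diff_algebra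
      \<Rightarrow> ('k, 'c::{ring,monoid_mult}, 'wc::{ring,monoid_mult}) diff_algebra
      \<Rightarrow> ('k, 'b, 'c) tensor \<Rightarrow> ('k, 'b, 'wb, 'c, 'wc) tensor_forms"
  where "tensor_diff B C t =
    (tensor_lift (scal B) (scal C) tscale UNIV UNIV
       (\<lambda>b c. pure_tensor (fscal B) (scal C) (diff B (emb B b)) c) t,
     tensor_lift (scal B) (scal C) tscale UNIV UNIV
       (\<lambda>b c. pure_tensor (scal B) (fscal C) b (diff C (emb C c))) t)"

text \<open>The left action \<open>(b \<otimes> c) \<cdot> (\<xi> \<otimes> c') = b\<xi> \<otimes> cc'\<close> and \<open>(b \<otimes> c) \<cdot> (b' \<otimes> \<eta>) = bb' \<otimes> c\<eta>\<close>.\<close>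

definition tensor_act ::
    "('k::field, 'b::{ring,monoid_mult}, 'wb::{ring,monoid_mult}) diff_algebra
      \<Rightarrow> ('k, 'c::{ring,monoid_mult}, 'wc::{ring,monoid_mult}) diff_algebra
      \<Rightarrow> ('k, 'b, 'c) tensor \<Rightarrow> ('k, 'b, 'wb, 'c, 'wc) tensor_forms
      \<Rightarrow> ('k, 'b, 'wb, 'c, 'wc) tensor_forms"
  where "tensor_act B C t \<omega> =
    (tensor_lift (scal B) (scal C) tscale UNIV UNIV (\<lambda>b c.
       tensor_lift (fscal B) (scal C) tscale (forms B 1) UNIV (\<lambda>\<xi> c'.
         pure_tensor (fscal B) (scal C) (emb B b * \<xi>) (c * c')) (fst \<omega>)) t,
     tensor_lift (scal B) (scal C) tscale UNIV UNIV (\<lambda>b c.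
       tensor_lift (scal B) (fscal C) tscale UNIV (forms C 1) (\<lambda>b' \<eta>.
         pure_tensor (scal B) (fscal C) (b * b') (emb C c * \<eta>)) (snd \<omega>)) t)"

definition differentiable_to_tensor ::
    "('k::field, 'a, 'wa::{ring,monoid_mult}) diff_algebra
      \<Rightarrow> ('k, 'b::{ring,monoid_mult}, 'wb::{ring,monoid_mult}) diff_algebra
      \<Rightarrow> ('k, 'c::{ring,monoid_mult}, 'wc::{ring,monoid_mult}) diff_algebra
      \<Rightarrow> ('a \<Rightarrow> ('k, 'b, 'c) tensor) \<Rightarrow> bool"
  where "differentiable_to_tensor A B C f \<longleftrightarrow>
    (\<exists>g. is_pushforward A tensor_forms_scale (tensor_act B C) (tensor_diff B C) f g)"

definition pushforward ::
    "('k::field, 'a, 'wa::{ring,monoid_mult}) diff_algebra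
      \<Rightarrow> ('k, 'b::{ring,monoid_mult}, 'wb::{ring,monoid_mult}) diff_algebra
      \<Rightarrow> ('k, 'c::{ring,monoid_mult}, 'wc::{ring,monoid_mult}) diff_algebra
      \<Rightarrow> ('a \<Rightarrow> ('k, 'b, 'c) tensor) \<Rightarrow> 'wa \<Rightarrow> ('k, 'b, 'wb, 'c, 'wc) tensor_forms"
  where "pushforward A B C f =
    (SOME g. is_pushforward A tensor_forms_scale (tensor_act B C) (tensor_diff B C) f g)"


section \<open>The braided Lie algebra and its action\<close>

text \<open>Elements are functions on the whole algebra of forms, of which only the restriction to
  one-forms matters.\<close>

definition braided_lie_algebra ::
    "('k::field, 'h::{ring,monoid_mult}, 'wh::{ring,monoid_mult}) diff_algebra \<Rightarrow> ('h \<Rightarrow> 'k)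
      \<Rightarrow> ('wh \<Rightarrow> 'k) set"
  where "braided_lie_algebra H \<epsilon> =
    {\<alpha>. linear_on (fscal H) (*) (forms H 1) \<alpha> \<and>
        (\<forall>\<xi>\<in>forms H 1. \<forall>h. \<alpha> (\<xi> * emb H h) = \<alpha> \<xi> * \<epsilon> h)}"

definition left_field ::
    "('k::field, 'h::{ring,monoid_mult}, 'wh::{ring,monoid_mult}) diff_algebra
      \<Rightarrow> ('h \<Rightarrow> ('k, 'h, 'h) tensor) \<Rightarrow> ('wh \<Rightarrow> 'k) \<Rightarrow> 'wh \<Rightarrow> 'h"
  where "left_field H \<Delta> \<alpha> \<xi> =
    tensor_lift (scal H) (fscal H) (scal H) UNIV (forms H 1) (\<lambda>h \<eta>. scal H (\<alpha> \<eta>) h)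
      (snd (pushforward H H H \<Delta> \<xi>))"

definition generated_field ::
    "('k::field, 'h::{ring,monoid_mult}, 'wh::{ring,monoid_mult}) diff_algebra
      \<Rightarrow> ('k, 'm::{ring,monoid_mult}, 'wm::{ring,monoid_mult}) diff_algebra
      \<Rightarrow> ('m \<Rightarrow> ('k, 'h, 'm) tensor) \<Rightarrow> ('wh \<Rightarrow> 'k) \<Rightarrow> 'wm \<Rightarrow> 'm"
  where "generated_field H M \<rho> \<alpha> \<xi> =
    tensor_lift (fscal H) (scal M) (scal M) (forms H 1) UNIV (\<lambda>\<eta> m. scal M (\<alpha> \<eta>) m)
      (fst (pushforward M H M \<rho> \<xi>))"


section \<open>Exponentials\<close>

text \<open>
  The scalar field \<open>\<real>\<close> or \<open>\<complex>\<close> is rendered by the sort \<open>{real_normed_field, banach}\<close>, whose only models are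
  these two up to isomorphism (Gelfand--Mazur).

  Convergence of a series all of whose terms lie in a finite-dimensional subspace (the span of the
  finite basis \<open>B\<close>): the usual topology of that subspace is coordinatewise convergence.
\<close>

definition fd_sums :: "('k::real_normed_field \<Rightarrow> 'b::ab_group_add \<Rightarrow> 'b) \<Rightarrow> (nat \<Rightarrow> 'b) \<Rightarrow> 'b \<Rightarrow> bool"
  where "fd_sums s x y \<longleftrightarrow>
    (\<exists>B. finite B \<and> \<not> module.dependent s B \<and> range x \<subseteq> module.span s B \<and> y \<in> module.span s B \<and>
      (\<forall>b\<in>B. (\<lambda>r. module.representation s B (x r) b) sums module.representation s B y b))"

definition exp_sums :: "('k::real_normed_field \<Rightarrow> 'b::ab_group_add \<Rightarrow> 'b) \<Rightarrow> ('b \<Rightarrow> 'b) \<Rightarrow> 'b \<Rightarrow> 'b \<Rightarrow> bool"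
  where "exp_sums s L x y \<longleftrightarrow> fd_sums s (\<lambda>r. s (1 / fact r) ((L ^^ r) x)) y"

text \<open>Meaningful only at points where \<^const>\<open>exp_sums\<close> holds for some limit.\<close>

definition operator_exp :: "('k::real_normed_field \<Rightarrow> 'b::ab_group_add \<Rightarrow> 'b) \<Rightarrow> ('b \<Rightarrow> 'b) \<Rightarrow> 'b \<Rightarrow> 'b"
  where "operator_exp s L x = (THE y. exp_sums s L x y)"

definition lie_exp ::
    "('k::real_normed_field, 'h::{ring,monoid_mult}, 'wh::{ring,monoid_mult}) diff_algebra
      \<Rightarrow> ('h \<Rightarrow> ('k, 'h, 'h) tensor) \<Rightarrow> ('h \<Rightarrow> 'k) \<Rightarrow> ('wh \<Rightarrow> 'k) \<Rightarrow> 'h \<Rightarrow> 'k"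
  where "lie_exp H \<Delta> \<epsilon> \<alpha> h = \<epsilon> (operator_exp (scal H) (lie_derivative H (left_field H \<Delta> \<alpha>)) h)"

end

theory Submission
  imports Defs
begin

text \<open>
  Put \<open>a(h) = \<alpha>(dh)\<close>.  As \<open>d\<close> on a tensor product has
  components \<open>d \<otimes> id\<close> and \<open>id \<otimes> d\<close>, the Lie derivatives on functions along \<open>\<Lambda>(\<alpha>)\<close> and \<open>L\<^sub>\<alpha>\<close> are \<open>D = (a \<otimes> id)\<lambda>\<close> and
  \<open>L = (id \<otimes> a)\<Delta>\<close>.  Coassociativity gives \<open>D\<^sup>r = (\<epsilon>L\<^sup>r \<otimes> id)\<lambda>\<close> and \<open>L\<^sup>r = (id \<otimes> \<epsilon>L\<^sup>r)\<Delta>\<close>, so every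
  orbit \<open>L\<^sup>rh\<close>, \<open>D\<^sup>rm\<close> lies in the span of finitely many tensor legs.  An orbit in a
  finite-dimensional space satisfies a linear recurrence, hence grows at most geometrically and its
  exponential series converges.  The two sides of the claim then agree under every linear functional.
\<close>

section \<open>Linear maps and tensors\<close>

text \<open>The functional \<open>\<epsilon>L^r\<close> is the \<open>r\<close>-th convolution power
  of \<open>a\<close>, so \<open>exp(\<alpha>)\<close> is the convolution exponential of
  \<open>a\<close>. The theorem expresses that the convolution algebra of functionals acts on
  \<open>M\<close> through the coaction. This action reverses products, which is invisible for
  powers of a single \<open>a\<close>. Two features shape the work. \<open>tensor_lift\<close> and
  \<open>pushforward\<close> are choices, known only through linearity on a subspace and their
  values on generators, so calculations expand tensors into finite sums of pure tensors and keep
  track of membership in the right tensor space. \<open>H\<close> and \<open>M\<close> carry no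
  norm, so growth, convergence and equality of limits are all tested on linear functionals, which
  separate points. That \<open>\<Lambda>(\<alpha>)\<close> is a right module map needs its own
  argument: the pushforward is prescribed on left multiples \<open>a db\<close>, and a right factor
  has to be absorbed by the Leibniz rule.\<close>

lemma linear_on_add: "linear_on s1 s2 A f \<Longrightarrow> x \<in> A \<Longrightarrow> y \<in> A \<Longrightarrow> f (x + y) = f x + f y"
  and linear_on_scale: "linear_on s1 s2 A f \<Longrightarrow> x \<in> A \<Longrightarrow> f (s1 c x) = s2 c (f x)"
  by (auto simp: linear_on_def)

lemma subspace_UNIV: "vector_space s \<Longrightarrow> module.subspace s UNIV"
  by (simp add: module.subspace_UNIV module_iff_vector_space)

lemma subspace_tensor_space: "module.subspace tscale (tensor_space s1 s2 A B)"
proof -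
  interpret T: vector_space "tscale :: 'a \<Rightarrow> ('a, 'b, 'c) tensor \<Rightarrow> _" by (rule vector_space_tscale)
  show ?thesis by (simp add: tensor_space_def)
qed

lemma linear_on_zero:
  assumes "vector_space s1" "vector_space s2" "linear_on s1 s2 A f" "module.subspace s1 A"
  shows "f 0 = 0"
proof -
  interpret V: vector_space s1 by fact
  interpret W: vector_space s2 by fact
  have "0 \<in> A" using assms(4) by (rule V.subspace_0)
  from linear_on_scale[OF assms(3) this, of 0] show ?thesis by simp
qed

lemma linear_on_sum:
  assumes "vector_space s1" "vector_space s2" "linear_on s1 s2 A f" "module.subspace s1 A"
    and "\<And>i. i \<in> I \<Longrightarrow> x i \<in> A"
  shows "f (\<Sum>i\<in>I. x i) = (\<Sum>i\<in>I. f (x i))"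
proof -
  interpret V: vector_space s1 by fact
  show ?thesis using assms(5)
  proof (induction I rule: infinite_finite_induct)
    case (insert i I)
    then have "(\<Sum>i\<in>I. x i) \<in> A" using assms(4) by (intro V.subspace_sum) auto
    with insert show ?case by (simp add: linear_on_add[OF assms(3)])
  qed (simp_all add: linear_on_zero[OF assms(1-4)])
qed

lemma linear_on_diff:
  assumes "vector_space s1" "vector_space s2" "linear_on s1 s2 A f" "module.subspace s1 A"
    and "x \<in> A" "y \<in> A"
  shows "f (x - y) = f x - f y"
proof -
  interpret V: vector_space s1 by fact
  have "x - y \<in> A" using assms(4-6) by (rule V.subspace_diff)
  from linear_on_add[OF assms(3) this \<open>y \<in> A\<close>] show ?thesis by simp
qed

lemma linear_on_span_eq:
  assumes "vector_space s1" "vector_space s2"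
    and "linear_on s1 s2 (module.span s1 S) f" "linear_on s1 s2 (module.span s1 S) g"
    and "\<And>x. x \<in> S \<Longrightarrow> f x = g x" "x \<in> module.span s1 S"
  shows "f x = g x"
proof -
  interpret V: vector_space s1 by fact
  \<comment> \<open>Membership is carried through the induction because \<open>linear_on\<close>
    gives additivity only inside the span.\<close>
  have "x \<in> V.span S \<and> f x = g x"
  proof (rule V.span_induct_alt[where h = "\<lambda>x. x \<in> V.span S \<and> f x = g x" and S = S])
    show "0 \<in> V.span S \<and> f 0 = g 0"
      using linear_on_zero[OF assms(1,2)] assms(3,4) by (metis V.subspace_span V.span_zero)
  next
    fix c y z assume y: "y \<in> S" and z: "z \<in> V.span S \<and> f z = g z"
    have "y \<in> V.span S" using y by (rule V.span_base)
    then show "s1 c y + z \<in> V.span S \<and> f (s1 c y + z) = g (s1 c y + z)"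
      using y z assms(5) by (simp add: V.span_add V.span_scale linear_on_add[OF assms(3)]
          linear_on_add[OF assms(4)] linear_on_scale[OF assms(3)] linear_on_scale[OF assms(4)])
  qed fact
  then show ?thesis by simp
qed

lemma bilinear_onI:
  assumes "\<And>a b b'. a \<in> A \<Longrightarrow> b \<in> B \<Longrightarrow> b' \<in> B \<Longrightarrow> f a (b + b') = f a b + f a b'"
    and "\<And>c a b. a \<in> A \<Longrightarrow> b \<in> B \<Longrightarrow> f a (s2 c b) = s3 c (f a b)"
    and "\<And>a a' b. a \<in> A \<Longrightarrow> a' \<in> A \<Longrightarrow> b \<in> B \<Longrightarrow> f (a + a') b = f a b + f a' b"
    and "\<And>c a b. a \<in> A \<Longrightarrow> b \<in> B \<Longrightarrow> f (s1 c a) b = s3 c (f a b)"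
  shows "bilinear_on s1 s2 s3 A B f"
  using assms by (simp add: bilinear_on_def linear_on_def)

section \<open>Finite sums of pure tensors\<close>

lemma pure_tensor_simps:
  shows pure_tensor_add_left: "pure_tensor s1 s2 (a + a') b = pure_tensor s1 s2 a b + pure_tensor s1 s2 a' b"
    and pure_tensor_add_right: "pure_tensor s1 s2 a (b + b') = pure_tensor s1 s2 a b + pure_tensor s1 s2 a b'"
    and pure_tensor_scale_left: "pure_tensor s1 s2 (s1 c a) b = tscale c (pure_tensor s1 s2 a b)"
    and pure_tensor_scale_right: "pure_tensor s1 s2 a (s2 c b) = tscale c (pure_tensor s1 s2 a b)"
  using bilinear_on_pure[of s1 s2] by (auto simp: bilinear_on_def linear_on_def)

lemma tensor_space_obtains_sum:
  fixes s1 :: "'k::field \<Rightarrow> 'v::ab_group_add \<Rightarrow> 'v" and s2 :: "'k \<Rightarrow> 'w::ab_group_add \<Rightarrow> 'w"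
  assumes "vector_space s1" "module.subspace s1 A" "t \<in> tensor_space s1 s2 A B"
  obtains n :: nat and a b where "\<And>i. i < n \<Longrightarrow> a i \<in> A" "\<And>i. i < n \<Longrightarrow> b i \<in> B"
    "t = (\<Sum>i<n. pure_tensor s1 s2 (a i) (b i))"
proof -
  interpret V: vector_space s1 by fact
  interpret T: vector_space "tscale :: 'k \<Rightarrow> ('k, 'v, 'w) tensor \<Rightarrow> _"
    by (rule vector_space_tscale)
  have "\<exists>(n :: nat) a b. (\<forall>i<n. a i \<in> A \<and> b i \<in> B) \<and> t = (\<Sum>i<n. pure_tensor s1 s2 (a i) (b i))"
  proof (rule T.span_induct_alt[where S = "{pure_tensor s1 s2 a b |a b. a \<in> A \<and> b \<in> B}" and
        h = "\<lambda>t. \<exists>(n :: nat) a b. (\<forall>i<n. a i \<in> A \<and> b i \<in> B) \<and> t = (\<Sum>i<n. pure_tensor s1 s2 (a i) (b i))"])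
    show "\<exists>(n :: nat) a b. (\<forall>i<n. a i \<in> A \<and> b i \<in> B) \<and> 0 = (\<Sum>i<n. pure_tensor s1 s2 (a i) (b i))"
      by (intro exI[of _ 0]) auto
  next
    fix c x y
    assume "x \<in> {pure_tensor s1 s2 a b |a b. a \<in> A \<and> b \<in> B}"
    then obtain a0 b0 where 0: "a0 \<in> A" "b0 \<in> B" "x = pure_tensor s1 s2 a0 b0" by blast
    assume "\<exists>(n :: nat) a b. (\<forall>i<n. a i \<in> A \<and> b i \<in> B) \<and> y = (\<Sum>i<n. pure_tensor s1 s2 (a i) (b i))"
    then obtain n :: nat and a b where 1: "\<forall>i<n. a i \<in> A \<and> b i \<in> B"
      and y: "y = (\<Sum>i<n. pure_tensor s1 s2 (a i) (b i))" by blast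
    \<comment> \<open>The coefficient \<open>c\<close> is absorbed into the left leg, so sums
      without coefficients suffice; this is where \<open>A\<close> being a subspace enters.\<close>
    let ?a = "a(n := s1 c a0)" and ?b = "b(n := b0)"
    have "(\<Sum>i<Suc n. pure_tensor s1 s2 (?a i) (?b i)) = tscale c x + y"
      by (simp add: 0(3) y pure_tensor_scale_left add.commute)
    moreover have "\<forall>i<Suc n. ?a i \<in> A \<and> ?b i \<in> B"
      using 0 1 assms(2) by (auto simp: less_Suc_eq intro: V.subspace_scale)
    ultimately show "\<exists>(n :: nat) a b. (\<forall>i<n. a i \<in> A \<and> b i \<in> B) \<and>
        tscale c x + y = (\<Sum>i<n. pure_tensor s1 s2 (a i) (b i))"
      by metis
  qed (use assms(3) in \<open>simp add: tensor_space_def\<close>)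
  with that show thesis by blast
qed

lemma range_tensor_space_obtains_sum:
  fixes s1 :: "'k::field \<Rightarrow> 'v::ab_group_add \<Rightarrow> 'v" and s2 :: "'k \<Rightarrow> 'w::ab_group_add \<Rightarrow> 'w"
  assumes "vector_space s1" "range f \<subseteq> tensor_space s1 s2 UNIV UNIV"
  obtains n :: nat and a b where "f x = (\<Sum>i<n. pure_tensor s1 s2 (a i) (b i))"
proof -
  have "f x \<in> tensor_space s1 s2 UNIV UNIV" using assms(2) by auto
  from tensor_space_obtains_sum[OF assms(1) subspace_UNIV[OF assms(1)] this] that show thesis by metis
qed

lemma sum_pure_in_tensor_space:
  assumes "\<And>i. i \<in> I \<Longrightarrow> a i \<in> A" "\<And>i. i \<in> I \<Longrightarrow> b i \<in> B"
  shows "(\<Sum>i\<in>I. pure_tensor s1 s2 (a i) (b i)) \<in> tensor_space s1 s2 A B"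
  using assms
  by (intro module.subspace_sum[OF _ subspace_tensor_space] pure_in_tensor_space)
    (auto simp: module_iff_vector_space vector_space_tscale)

text \<open>The evaluation rule behind all later calculations: \<open>tensor_lift\<close> is a
  chosen map, accessible only through linearity on the tensor space and its values on pure
  tensors.\<close>

lemma tensor_lift_sum:
  assumes vs: "vector_space s1" "vector_space s2" "vector_space s3"
    "module.subspace s1 A" "module.subspace s2 B" "bilinear_on s1 s2 s3 A B f"
    and "\<And>i. i \<in> I \<Longrightarrow> a i \<in> A" "\<And>i. i \<in> I \<Longrightarrow> b i \<in> B"
  shows "tensor_lift s1 s2 s3 A B f (\<Sum>i\<in>I. pure_tensor s1 s2 (a i) (b i)) = (\<Sum>i\<in>I. f (a i) (b i))"
  using assms(7,8)
  by (simp add: linear_on_sum[OF vector_space_tscale vs(3) tensor_universal(1)[OF vs]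
        subspace_tensor_space] pure_in_tensor_space tensor_universal(2)[OF vs])

lemma tensor_lift_sum_UNIV:
  assumes vs: "vector_space s1" "vector_space s2" "vector_space s3"
    "bilinear_on s1 s2 s3 UNIV UNIV f"
  shows "tensor_lift s1 s2 s3 UNIV UNIV f (\<Sum>i\<in>I. pure_tensor s1 s2 (a i) (b i)) = (\<Sum>i\<in>I. f (a i) (b i))"
  using assms by (intro tensor_lift_sum) (simp_all add: subspace_UNIV)

lemma tensor_lift_linear_UNIV:
  assumes vs: "vector_space s1" "vector_space s2" "vector_space s3"
    "bilinear_on s1 s2 s3 UNIV UNIV f"
  shows "linear_on tscale s3 (tensor_space s1 s2 UNIV UNIV) (tensor_lift s1 s2 s3 UNIV UNIV f)"
  using assms by (intro tensor_universal) (simp_all add: subspace_UNIV)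

lemma bilinear_on_scaled:
  assumes "vector_space s1" "vector_space s2" "linear_on s1 (*) A a"
  shows "bilinear_on s1 s2 s2 A B (\<lambda>x y. s2 (a x) y)"
proof -
  interpret vector_space s2 by fact
  show ?thesis using linear_on_add[OF assms(3)] linear_on_scale[OF assms(3)]
    by (intro bilinear_onI) (simp_all add: scale_right_distrib scale_left_distrib mult.commute)
qed

lemma bilinear_on_scaled_right:
  assumes "vector_space s1" "vector_space s2" "linear_on s2 (*) B a"
  shows "bilinear_on s1 s2 s1 A B (\<lambda>x y. s1 (a y) x)"
proof -
  interpret vector_space s1 by fact
  show ?thesis using linear_on_add[OF assms(3)] linear_on_scale[OF assms(3)]
    by (intro bilinear_onI) (simp_all add: scale_right_distrib scale_left_distrib mult.commute)
qed

text \<open>A trilinear map factors through both bracketings of the triple tensor product. Applying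
  the linear map induced on \<open>U \<otimes> (V \<otimes> W)\<close> to both sides of
  \<open>eq\<close> turns an equation of nested tensors into one of ordinary finite sums.\<close>

lemma tensor_assoc_trilinear:
  fixes s1 :: "'k::field \<Rightarrow> 'u::ab_group_add \<Rightarrow> 'u" and s2 :: "'k \<Rightarrow> 'v::ab_group_add \<Rightarrow> 'v"
    and s3 :: "'k \<Rightarrow> 'w::ab_group_add \<Rightarrow> 'w" and sz :: "'k \<Rightarrow> 'z::ab_group_add \<Rightarrow> 'z"
  assumes vs: "vector_space s1" "vector_space s2" "vector_space s3" "vector_space sz"
    and P: "\<And>i. P i \<in> tensor_space s1 s2 UNIV UNIV"
    and Q: "\<And>i. Q i \<in> tensor_space s2 s3 UNIV UNIV"
    and eq: "tensor_assoc s1 s2 s3 (\<Sum>i<n::nat. pure_tensor tscale s3 (P i) (x i))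
      = (\<Sum>i<n. pure_tensor s1 tscale (y i) (Q i))"
    and f23: "\<And>u. bilinear_on s2 s3 sz UNIV UNIV (f u)"
    and f1: "\<And>v w. linear_on s1 sz UNIV (\<lambda>u. f u v w)"
  shows "(\<Sum>i<n. tensor_lift s1 s2 sz UNIV UNIV (\<lambda>u v. f u v (x i)) (P i))
    = (\<Sum>i<n. tensor_lift s2 s3 sz UNIV UNIV (f (y i)) (Q i))"
proof -
  let ?T12 = "tensor_space s1 s2 UNIV UNIV" and ?T23 = "tensor_space s2 s3 UNIV UNIV"
  \<comment> \<open>The second leg is restricted to \<open>?T23\<close> because the type of tensors
    contains more functions than genuine tensors.\<close>
  let ?G = "tensor_lift s1 tscale sz UNIV ?T23 (\<lambda>u. tensor_lift s2 s3 sz UNIV UNIV (f u))"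
  interpret S1: vector_space s1 by fact
  interpret Z: vector_space sz by fact
  have f12: "bilinear_on s1 s2 sz UNIV UNIV (\<lambda>u v. f u v w)" for w
    using f23 f1 by (simp add: bilinear_on_def linear_on_def)
  have B: "bilinear_on s1 tscale sz UNIV ?T23 (\<lambda>u. tensor_lift s2 s3 sz UNIV UNIV (f u))"
    unfolding bilinear_on_def
  proof safe
    fix u show "linear_on tscale sz ?T23 (tensor_lift s2 s3 sz UNIV UNIV (f u))"
      by (rule tensor_lift_linear_UNIV) fact+
  next
    fix t assume "t \<in> ?T23"
    then obtain n :: nat and a b where "t = (\<Sum>i<n. pure_tensor s2 s3 (a i) (b i))"
      using tensor_space_obtains_sum[OF vs(2) subspace_UNIV[OF vs(2)]] by metis
    \<comment> \<open>One expansion of \<open>t\<close> serves all \<open>u\<close>, so linearity in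
      \<open>u\<close> is inherited term by term from \<open>f\<close>.\<close>
    then have "tensor_lift s2 s3 sz UNIV UNIV (f u) t = (\<Sum>i<n. f u (a i) (b i))" for u
      by (simp add: tensor_lift_sum_UNIV[OF vs(2-4) f23])
    then show "linear_on s1 sz UNIV (\<lambda>u. tensor_lift s2 s3 sz UNIV UNIV (f u) t)"
      using f1 by (simp add: linear_on_def sum.distrib Z.scale_sum_right)
  qed
  have A12: "bilinear_on s1 s2 tscale UNIV UNIV (\<lambda>u v. pure_tensor s1 tscale u (pure_tensor s2 s3 v w))" for w
    by (rule bilinear_onI) (simp_all add: pure_tensor_simps)
  have A: "bilinear_on tscale s3 tscale ?T12 UNIV (\<lambda>t w.
      tensor_lift s1 s2 tscale UNIV UNIV (\<lambda>u v. pure_tensor s1 tscale u (pure_tensor s2 s3 v w)) t)"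
    unfolding bilinear_on_def
  proof safe
    fix w show "linear_on tscale tscale ?T12 (tensor_lift s1 s2 tscale UNIV UNIV
      (\<lambda>u v. pure_tensor s1 tscale u (pure_tensor s2 s3 v w)))"
      by (rule tensor_lift_linear_UNIV[OF vs(1,2) vector_space_tscale A12])
  next
    fix t assume "t \<in> ?T12"
    then obtain n :: nat and a b where "t = (\<Sum>i<n. pure_tensor s1 s2 (a i) (b i))"
      using tensor_space_obtains_sum[OF vs(1) subspace_UNIV[OF vs(1)]] by metis
    then have "tensor_lift s1 s2 tscale UNIV UNIV (\<lambda>u v. pure_tensor s1 tscale u (pure_tensor s2 s3 v w)) t
        = (\<Sum>i<n. pure_tensor s1 tscale (a i) (pure_tensor s2 s3 (b i) w))" for w
      by (simp add: tensor_lift_sum_UNIV[OF vs(1,2) vector_space_tscale A12])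
    then show "linear_on s3 tscale UNIV (\<lambda>w. tensor_lift s1 s2 tscale UNIV UNIV
        (\<lambda>u v. pure_tensor s1 tscale u (pure_tensor s2 s3 v w)) t)"
      by (simp add: linear_on_def sum.distrib pure_tensor_simps
          module.scale_sum_right[OF vector_space_tscale[folded module_iff_vector_space]])
  qed
  note G = tensor_lift_sum[OF vs(1) vector_space_tscale vs(4) subspace_UNIV[OF vs(1)] subspace_tensor_space B]
  note As = tensor_lift_sum[OF vector_space_tscale vs(3) vector_space_tscale subspace_tensor_space
      subspace_UNIV[OF vs(3)] A, folded tensor_assoc_def]
  \<comment> \<open>The computation on one summand \<open>t \<otimes> w\<close>. The membership in
    the second conjunct is what later allows \<open>?G\<close> to be distributed over the sum, since
    \<open>?G\<close> is linear only on that space.\<close>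
  have step: "?G (tensor_lift s1 s2 tscale UNIV UNIV (\<lambda>u v. pure_tensor s1 tscale u (pure_tensor s2 s3 v w)) t)
      = tensor_lift s1 s2 sz UNIV UNIV (\<lambda>u v. f u v w) t
      \<and> tensor_lift s1 s2 tscale UNIV UNIV (\<lambda>u v. pure_tensor s1 tscale u (pure_tensor s2 s3 v w)) t
        \<in> tensor_space s1 tscale UNIV ?T23" if t12: "t \<in> ?T12" for t w
  proof -
    obtain n :: nat and a b where t: "t = (\<Sum>i<n. pure_tensor s1 s2 (a i) (b i))"
      using tensor_space_obtains_sum[OF vs(1) subspace_UNIV[OF vs(1)] t12] by metis
    have 1: "tensor_lift s1 s2 tscale UNIV UNIV (\<lambda>u v. pure_tensor s1 tscale u (pure_tensor s2 s3 v w)) t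
        = (\<Sum>i<n. pure_tensor s1 tscale (a i) (pure_tensor s2 s3 (b i) w))"
      by (simp add: t tensor_lift_sum_UNIV[OF vs(1,2) vector_space_tscale A12])
    show ?thesis unfolding 1
      by (simp add: G pure_in_tensor_space sum_pure_in_tensor_space tensor_universal(2)[OF vs(2-4) subspace_UNIV[OF vs(2)] subspace_UNIV[OF vs(3)] f23]
          t tensor_lift_sum_UNIV[OF vs(1,2,4) f12])
  qed
  have "(\<Sum>i<n. tensor_lift s1 s2 sz UNIV UNIV (\<lambda>u v. f u v (x i)) (P i))
    = ?G (tensor_assoc s1 s2 s3 (\<Sum>i<n. pure_tensor tscale s3 (P i) (x i)))"
    using step[OF P]
    by (simp add: As P linear_on_sum[OF vector_space_tscale vs(4) tensor_universal(1)[OF vs(1)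
          vector_space_tscale vs(4) subspace_UNIV[OF vs(1)] subspace_tensor_space B] subspace_tensor_space])
  also have "\<dots> = (\<Sum>i<n. tensor_lift s2 s3 sz UNIV UNIV (f (y i)) (Q i))"
    by (simp add: eq G Q)
  finally show ?thesis .
qed

section \<open>Exponentials of locally finite operators\<close>

lemma linear_functional_representation:
  assumes "vector_space s" "finite B" "\<not> module.dependent s B" "v \<in> module.span s B"
    and "Vector_Spaces.linear s (*) \<phi>"
  shows "\<phi> v = (\<Sum>b\<in>B. module.representation s B v b * \<phi> b)"
proof -
  interpret vector_space_pair s "(*)"
    using assms(1) vector_space_field by (simp add: vector_space_pair_def)
  have "\<phi> v = \<phi> (\<Sum>b\<in>B. s (vs1.representation B v b) b)"
    using vs1.sum_representation_eq[OF assms(3,4,2)] by simp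
  then show ?thesis by (simp add: linear_sum[OF assms(5)] linear_scale[OF assms(5)])
qed

text \<open>Replaces convergence of coordinates, which refers to some basis, by a statement about
  functionals on the whole space in which no basis occurs.\<close>

lemma fd_sums_functional:
  assumes "vector_space s" "fd_sums s x y" "Vector_Spaces.linear s (*) \<phi>"
  shows "(\<lambda>r. \<phi> (x r)) sums \<phi> y"
proof -
  obtain B where B: "finite B" "\<not> module.dependent s B" "range x \<subseteq> module.span s B"
      "y \<in> module.span s B"
    and sums: "\<And>b. b \<in> B \<Longrightarrow> (\<lambda>r. module.representation s B (x r) b) sums module.representation s B y b"
    using assms(2) unfolding fd_sums_def by auto
  note rep = linear_functional_representation[OF assms(1) B(1,2) _ assms(3)]
  have "x r \<in> module.span s B" for r using B(3) by auto
  then show ?thesis unfolding rep[OF B(4)] by (simp add: rep sums_sum sums_mult2 sums)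
qed

text \<open>The two hypotheses may come with different finite bases; testing against functionals
  removes this dependence.\<close>

lemma fd_sums_unique:
  assumes "vector_space s" "fd_sums s x y" "fd_sums s x z"
  shows "y = z"
proof (rule functionals_separate[OF assms(1)])
  fix \<phi> assume "Vector_Spaces.linear s (*) \<phi>"
  from assms(2,3)[THEN fd_sums_functional[OF assms(1) _ this]] show "\<phi> y = \<phi> z"
    by (rule sums_unique2)
qed

text \<open>A partial converse of \<open>fd_sums_functional\<close>: each coordinate of a finite
  basis extends to a functional on the whole space, so summability under all functionals gives
  summability of all coordinates.\<close>

lemma fd_sums_ex:
  fixes s :: "'k::real_normed_field \<Rightarrow> 'b::ab_group_add \<Rightarrow> 'b"
  assumes "vector_space s" "finite B" "range x \<subseteq> module.span s B"
    and summable: "\<And>\<phi>. Vector_Spaces.linear s (*) \<phi> \<Longrightarrow> summable (\<lambda>r. \<phi> (x r))"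
  shows "\<exists>y. fd_sums s x y"
proof -
  interpret vector_space_pair s "(*)"
    using assms(1) vector_space_field by (simp add: vector_space_pair_def)
  \<comment> \<open>\<open>B\<close> is only a spanning set, whereas \<open>fd_sums\<close> asks for
    a basis.\<close>
  obtain C where C: "C \<subseteq> B" "vs1.independent C" "B \<subseteq> vs1.span C"
    by (rule vs1.maximal_independent_subset)
  have fin: "finite C" using C(1) assms(2) by (rule finite_subset)
  have x: "x r \<in> vs1.span C" for r
    using assms(3) C(3) by (meson range_subsetD vs1.span_minimal vs1.subspace_span subsetD)
  define R where "R r b = vs1.representation C (x r) b" for r b
  have "summable (\<lambda>r. R r b)" if b: "b \<in> C" for b
  proof -
    obtain \<phi> where \<phi>: "Vector_Spaces.linear s (*) \<phi>" "\<And>c. c \<in> C \<Longrightarrow> \<phi> c = (if c = b then 1 else 0)"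
      using linear_independent_extend[OF C(2), of "\<lambda>c. if c = b then 1 else 0"] by auto
    have "\<phi> (x r) = R r b" for r
      using b fin by (simp add: linear_functional_representation[OF assms(1) fin C(2) x \<phi>(1)] \<phi>(2) R_def
          if_distrib[of "\<lambda>z. _ * z"] cong: if_cong)
    with summable[OF \<phi>(1)] show ?thesis by simp
  qed
  then have sums: "(\<lambda>r. R r b) sums (\<Sum>r. R r b)" if "b \<in> C" for b
    using that by (simp add: summable_sums)
  define y where "y = (\<Sum>b\<in>C. s (\<Sum>r. R r b) b)"
  have y: "y \<in> vs1.span C"
    unfolding y_def by (intro vs1.span_sum vs1.span_scale vs1.span_base)
  have "vs1.representation C y b = (\<Sum>r. R r b)" if "b \<in> C" for b
    unfolding y_def using C(2) that fin
    by (simp add: vs1.representation_sum vs1.representation_scale vs1.representation_basis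
        vs1.span_base vs1.span_scale if_distrib[of "\<lambda>z. _ * z"] cong: if_cong)
  with fin C(2) x y sums show ?thesis
    unfolding fd_sums_def R_def by (intro exI[of _ y] exI[of _ C]) auto
qed

section \<open>Growth of orbits and convergence of the exponential series\<close>

lemma finite_span_recurrence:
  fixes x :: "nat \<Rightarrow> 'b::ab_group_add"
  assumes "vector_space s" "finite B" "range x \<subseteq> module.span s B"
  shows "\<exists>n. x n \<in> module.span s (x ` {..<n})"
proof (rule ccontr)
  interpret vector_space s by fact
  assume no: "\<nexists>n. x n \<in> span (x ` {..<n})"
  \<comment> \<open>Without a recurrence every initial segment is independent with distinct terms,
    but \<open>card B + 1\<close> independent vectors do not fit into the span of
    \<open>card B\<close> vectors.\<close>
  have "independent (x ` {..<n}) \<and> card (x ` {..<n}) = n" for n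
  proof (induction n)
    case (Suc n)
    have new: "x n \<notin> span (x ` {..<n})" using no by simp
    moreover have "x n \<notin> x ` {..<n}"
      using new span_base[of "x n" "x ` {..<n}"] by argo
    ultimately show ?case using Suc by (simp add: lessThan_Suc independent_insert)
  qed (simp add: independent_empty)
  moreover have "x ` {..<Suc (card B)} \<subseteq> span B" using assms(3) by auto
  ultimately show False
    using independent_span_bound[OF assms(2), of "x ` {..<Suc (card B)}"] by simp
qed

text \<open>One linear relation expressing \<open>L^n x\<close> by earlier orbit vectors becomes,
  after applying \<open>L^q\<close>, a recurrence of order \<open>n\<close> at every index
  \<open>q + n\<close>. Strong induction then bounds the scalar sequence.\<close>

lemma orbit_functional_bound:
  fixes s :: "'k::real_normed_field \<Rightarrow> 'b::ab_group_add \<Rightarrow> 'b"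
  assumes "vector_space s" "finite B" "\<And>r. (L ^^ r) x \<in> module.span s B"
    and L: "Vector_Spaces.linear s s L" and \<phi>: "Vector_Spaces.linear s (*) \<phi>"
  obtains C K where "\<And>r. norm (\<phi> ((L ^^ r) x)) \<le> C * K ^ r"
proof -
  interpret vector_space s by fact
  interpret L: vector_space_pair s s by unfold_locales
  interpret F: vector_space_pair s "(*)"
    using assms(1) vector_space_field by (simp add: vector_space_pair_def)
  define X where "X r = (L ^^ r) x" for r
  have "range X \<subseteq> span B" using assms(3) unfolding X_def by blast
  from finite_span_recurrence[OF assms(1,2) this]
  obtain n where n: "X n \<in> span (X ` {..<n})" by blast
  then obtain u where u: "X n = (\<Sum>v\<in>X ` {..<n}. s (u v) v)"
    unfolding span_finite[OF finite_imageI[OF finite_lessThan]] by blast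
  have "\<forall>v\<in>X ` {..<n}. \<exists>j. j < n \<and> X j = v" by auto
  \<comment> \<open>The relation is indexed by the set of orbit vectors, where repeated vectors
    coincide; \<open>i\<close> picks one position for each of them.\<close>
  from bchoice[OF this] obtain i where i: "\<And>v. v \<in> X ` {..<n} \<Longrightarrow> i v < n \<and> X (i v) = v"
    by blast
  have pow: "Vector_Spaces.linear s s (L ^^ q)" for q
    using L by (induction q) (simp_all add: Vector_Spaces.linear_iff)
  have rec: "X (q + n) = (\<Sum>v\<in>X ` {..<n}. s (u v) (X (q + i v)))" for q
  proof -
    have "X (q + n) = (L ^^ q) (X n)" by (simp add: X_def funpow_add)
    also have "\<dots> = (\<Sum>v\<in>X ` {..<n}. s (u v) ((L ^^ q) v))"
      by (simp add: u L.linear_sum[OF pow] L.linear_scale[OF pow])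
    also have "\<dots> = (\<Sum>v\<in>X ` {..<n}. s (u v) (X (q + i v)))"
    proof (rule sum.cong)
      fix v assume "v \<in> X ` {..<n}"
      with i have "(L ^^ q) v = (L ^^ q) (X (i v))" by simp
      then show "s (u v) ((L ^^ q) v) = s (u v) (X (q + i v))" by (simp add: X_def funpow_add)
    qed simp
    finally show ?thesis .
  qed
  \<comment> \<open>\<open>C\<close> covers the first \<open>n\<close> terms. The summand
    \<open>1\<close> makes the powers of \<open>K\<close> increasing, so all \<open>n\<close>
    predecessors are bounded by \<open>C * K ^ (r - 1)\<close>; the coefficients then contribute
    only the factor \<open>K - 1\<close>.\<close>
  define K where "K = 1 + (\<Sum>v\<in>X ` {..<n}. norm (u v))"
  define C where "C = (\<Sum>j<n. norm (\<phi> (X j)))"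
  have K: "K \<ge> 1" and C: "C \<ge> 0" by (auto simp: K_def C_def intro!: sum_nonneg)
  have "norm (\<phi> (X r)) \<le> C * K ^ r" for r
  proof (induction r rule: less_induct)
    case (less r)
    show ?case
    proof (cases "r < n")
      case True
      then have "norm (\<phi> (X r)) \<le> C"
        unfolding C_def by (intro member_le_sum) auto
      also have "\<dots> \<le> C * K ^ r" using K C by (simp add: mult_le_cancel_left1)
      finally show ?thesis .
    next
      case False
      then obtain q where r: "r = q + n" by (metis add.commute le_Suc_ex not_less)
      have "norm (\<phi> (X r)) = norm (\<Sum>v\<in>X ` {..<n}. u v * \<phi> (X (q + i v)))"
        by (simp add: r rec F.linear_sum[OF \<phi>] F.linear_scale[OF \<phi>])
      also have "\<dots> \<le> (\<Sum>v\<in>X ` {..<n}. norm (u v) * (C * K ^ (r - 1)))"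
      proof (rule sum_norm_le)
        fix v assume "v \<in> X ` {..<n}"
        then have iv: "i v < n" using i by blast
        then have "norm (\<phi> (X (q + i v))) \<le> C * K ^ (q + i v)" by (intro less) (simp add: r)
        also have "\<dots> \<le> C * K ^ (r - 1)"
          using iv K C by (intro mult_left_mono power_increasing) (auto simp: r)
        finally show "norm (u v * \<phi> (X (q + i v))) \<le> norm (u v) * (C * K ^ (r - 1))"
          by (simp add: norm_mult mult_left_mono)
      qed
      also have "\<dots> = (K - 1) * (C * K ^ (r - 1))" by (simp add: K_def sum_distrib_right)
      also have "\<dots> \<le> C * K ^ r"
      proof (cases r)
        \<comment> \<open>Here \<open>n = 0\<close>, so the relation is empty, \<open>K = 1\<close>
          and the left side vanishes; the truncated \<open>r - 1\<close> does no harm.\<close>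
        case 0
        then show ?thesis using r C by (simp add: K_def)
      next
        case (Suc k)
        have "(K - 1) * (C * K ^ k) \<le> K * (C * K ^ k)" using K C by (intro mult_right_mono) auto
        then show ?thesis by (simp add: Suc mult_ac)
      qed
      finally show ?thesis .
    qed
  qed
  from that[OF this[unfolded X_def]] show thesis .
qed

text \<open>Under each functional the terms are dominated by \<open>C * K ^ r / fact r\<close>.
  Completeness of the scalars enters through the comparison test.\<close>

lemma exp_sums_ex:
  fixes s :: "'k::{real_normed_field,banach} \<Rightarrow> 'b::ab_group_add \<Rightarrow> 'b"
  assumes s: "vector_space s" and B: "finite B" "\<And>r. (L ^^ r) x \<in> module.span s B"
    and L: "linear_on s s UNIV L"
  shows "\<exists>y. exp_sums s L x y"
  unfolding exp_sums_def
proof (rule fd_sums_ex[OF s B(1)])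
  interpret vector_space s by fact
  show "range (\<lambda>r. s (1 / fact r) ((L ^^ r) x)) \<subseteq> span B" using B(2) by (auto intro: span_scale)
  fix \<phi> assume \<phi>: "Vector_Spaces.linear s (*) \<phi>"
  have "Vector_Spaces.linear s s L" using L by (simp add: linear_on_UNIV[OF s s])
  from orbit_functional_bound[OF s B this \<phi>] obtain C K
    where CK: "\<And>r. norm (\<phi> ((L ^^ r) x)) \<le> C * K ^ r" by metis
  have eq: "\<phi> (s (1 / fact r) ((L ^^ r) x)) = 1 / fact r * \<phi> ((L ^^ r) x)" for r
    using \<phi> by (simp add: Vector_Spaces.linear_iff)
  show "summable (\<lambda>r. \<phi> (s (1 / fact r) ((L ^^ r) x)))"
  proof (rule summable_comparison_test)
    show "summable (\<lambda>r. C * (inverse (fact r) * K ^ r))" by (intro summable_mult summable_exp)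
    have "norm (\<phi> (s (1 / fact r) ((L ^^ r) x))) \<le> C * (inverse (fact r) * K ^ r)" for r
    proof -
      have "norm (\<phi> ((L ^^ r) x)) * inverse (fact r) \<le> (C * K ^ r) * inverse (fact r)"
        using CK by (rule mult_right_mono) simp
      then show ?thesis unfolding eq by (simp add: norm_mult norm_divide norm_inverse divide_inverse mult_ac)
    qed
    then show "\<exists>N. \<forall>n\<ge>N. norm (\<phi> (s (1 / fact n) ((L ^^ n) x))) \<le> C * (inverse (fact n) * K ^ n)" by blast
  qed
qed

text \<open>Existence together with \<open>fd_sums_unique\<close> makes the definite description in
  \<open>operator_exp\<close> denote the limit.\<close>

lemma operator_exp_sums:
  assumes "vector_space s" "\<exists>y. exp_sums s L x y" "Vector_Spaces.linear s (*) \<phi>"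
  shows "(\<lambda>r. 1 / fact r * \<phi> ((L ^^ r) x)) sums \<phi> (operator_exp s L x)"
proof -
  obtain y where y: "exp_sums s L x y" using assms(2) by blast
  then have "operator_exp s L x = y"
    unfolding operator_exp_def exp_sums_def by (blast intro: the_equality fd_sums_unique[OF assms(1)])
  moreover have "\<phi> (s (1 / fact r) ((L ^^ r) x)) = 1 / fact r * \<phi> ((L ^^ r) x)" for r
    using assms(3) by (simp add: Vector_Spaces.linear_iff)
  ultimately show ?thesis
    using fd_sums_functional[OF assms(1) y[unfolded exp_sums_def] assms(3)] by simp
qed

section \<open>One-forms on a tensor product\<close>

lemma tscale_sum: "tscale c (\<Sum>i\<in>I. x i) = (\<Sum>i\<in>I. tscale c (x i))"
  by (rule module.scale_sum_right[OF vector_space_tscale[folded module_iff_vector_space]])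

lemma unital_algebraD:
  assumes "unital_algebra s"
  shows "vector_space s" "s c x * y = s c (x * y)" "x * s c y = s c (x * y)"
  using assms unfolding unital_algebra_def by metis+

lemma tensor_mult_sum:
  assumes s1: "unital_algebra s1" and s2: "unital_algebra s2"
  shows "tensor_mult s1 s2 (\<Sum>i\<in>I. pure_tensor s1 s2 (a i) (b i)) (\<Sum>j\<in>J. pure_tensor s1 s2 (c j) (d j))
    = (\<Sum>i\<in>I. \<Sum>j\<in>J. pure_tensor s1 s2 (a i * c j) (b i * d j))"
proof -
  note vs = unital_algebraD(1)[OF s1] unital_algebraD(1)[OF s2] vector_space_tscale
  note alg = unital_algebraD(2,3)[OF s1] unital_algebraD(2,3)[OF s2]
  have 1: "bilinear_on s1 s2 tscale UNIV UNIV (\<lambda>c d. pure_tensor s1 s2 (a * c) (b * d))" for a b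
    by (rule bilinear_onI) (simp_all add: distrib_left alg pure_tensor_simps)
  have 2: "bilinear_on s1 s2 tscale UNIV UNIV (\<lambda>a b. \<Sum>j\<in>J. pure_tensor s1 s2 (a * c j) (b * d j))"
    by (rule bilinear_onI) (simp_all add: distrib_right alg pure_tensor_simps sum.distrib tscale_sum)
  show ?thesis
    unfolding tensor_mult_def tensor_lift_sum_UNIV[OF vs 1] tensor_lift_sum_UNIV[OF vs 2] ..
qed

lemma differential_structureD:
  assumes "differential_structure B"
  shows ds_scal: "unital_algebra (scal B)"
    and ds_fscal: "unital_algebra (fscal B)"
    and ds_subspace: "module.subspace (fscal B) (forms B n)"
    and ds_emb_add: "emb B (a + b) = emb B a + emb B b"
    and ds_emb_scale: "emb B (scal B c a) = fscal B c (emb B a)"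
    and ds_emb_one: "emb B 1 = 1"
    and ds_emb_mult: "emb B (a * b) = emb B a * emb B b"
    and ds_diff_add: "diff B (x + y) = diff B x + diff B y"
    and ds_diff_scale: "diff B (fscal B c x) = fscal B c (diff B x)"
    and ds_diff_emb: "diff B (emb B b) \<in> forms B 1"
    and ds_left_mult: "\<xi> \<in> forms B 1 \<Longrightarrow> emb B b * \<xi> \<in> forms B 1"
    and ds_right_mult: "\<xi> \<in> forms B 1 \<Longrightarrow> \<xi> * emb B b \<in> forms B 1"
    and ds_leibniz: "diff B (emb B a * emb B b) = diff B (emb B a) * emb B b + emb B a * diff B (emb B b)"
    and ds_span: "forms B 1 = module.span (fscal B) {emb B b * diff B (emb B b') |b b'. True}"
proof -
  note ds = assms[unfolded differential_structure_def]
  have emb0: "range (emb B) = forms B 0" using ds by (auto simp: bij_betw_def)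
  then have emb: "emb B b \<in> forms B 0" for b by auto
  show "unital_algebra (scal B)" "unital_algebra (fscal B)" "module.subspace (fscal B) (forms B n)"
    "emb B (a + b) = emb B a + emb B b" "emb B (scal B c a) = fscal B c (emb B a)"
    "emb B 1 = 1" "emb B (a * b) = emb B a * emb B b" "diff B (x + y) = diff B x + diff B y"
    "diff B (fscal B c x) = fscal B c (diff B x)"
    using ds by (simp_all add: linear_on_def)
  have mult: "x \<in> forms B m \<Longrightarrow> y \<in> forms B n \<Longrightarrow> x * y \<in> forms B (m + n)" for x y m n
    using ds by blast
  show "\<xi> \<in> forms B 1 \<Longrightarrow> emb B b * \<xi> \<in> forms B 1" using mult[OF emb, of \<xi> 1 b] by simp
  show "\<xi> \<in> forms B 1 \<Longrightarrow> \<xi> * emb B b \<in> forms B 1" using mult[OF _ emb, of \<xi> 1 b] by simp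
  have "\<forall>n. \<forall>x\<in>forms B n. diff B x \<in> forms B (Suc n)" using ds by blast
  with emb have "diff B (emb B b) \<in> forms B (Suc 0)" by blast
  then show "diff B (emb B b) \<in> forms B 1" by simp
  have "\<forall>n. \<forall>x\<in>forms B n. \<forall>y. diff B (x * y) = diff B x * y + (- 1) ^ n * x * diff B y"
    using ds by blast
  from this[rule_format, OF emb[of a], of "emb B b"]
  show "diff B (emb B a * emb B b) = diff B (emb B a) * emb B b + emb B a * diff B (emb B b)" by simp
  have "forms B (Suc 0) = module.span (fscal B) {emb B b * diff B x |b x. x \<in> forms B 0}"
    using ds by blast
  also have "{emb B b * diff B x |b x. x \<in> forms B 0} = {emb B b * diff B (emb B b') |b b'. True}"
    unfolding emb0[symmetric] by auto
  finally show "forms B 1 = module.span (fscal B) {emb B b * diff B (emb B b') |b b'. True}" by simp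
qed

lemma tensor_act_sum:
  assumes B: "differential_structure B" and C: "differential_structure C"
    and t: "t = (\<Sum>i\<in>I. pure_tensor (scal B) (scal C) (b i) (c i))"
  shows fst_tensor_act_sum: "(\<And>j. j \<in> J \<Longrightarrow> \<xi> j \<in> forms B 1) \<Longrightarrow>
      fst \<omega> = (\<Sum>j\<in>J. pure_tensor (fscal B) (scal C) (\<xi> j) (c' j)) \<Longrightarrow>
      fst (tensor_act B C t \<omega>)
        = (\<Sum>i\<in>I. \<Sum>j\<in>J. pure_tensor (fscal B) (scal C) (emb B (b i) * \<xi> j) (c i * c' j))"
    and snd_tensor_act_sum: "(\<And>j. j \<in> J \<Longrightarrow> \<eta> j \<in> forms C 1) \<Longrightarrow>
      snd \<omega> = (\<Sum>j\<in>J. pure_tensor (scal B) (fscal C) (b' j) (\<eta> j)) \<Longrightarrow>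
      snd (tensor_act B C t \<omega>)
        = (\<Sum>i\<in>I. \<Sum>j\<in>J. pure_tensor (scal B) (fscal C) (b i * b' j) (emb C (c i) * \<eta> j))"
proof -
  note sB = ds_scal[OF B] ds_fscal[OF B] and sC = ds_scal[OF C] ds_fscal[OF C]
  note vs = sB[THEN unital_algebraD(1)] sC[THEN unital_algebraD(1)] vector_space_tscale
  note alg = unital_algebraD(2,3)[OF sB(1)] unital_algebraD(2,3)[OF sB(2)]
    unital_algebraD(2,3)[OF sC(1)] unital_algebraD(2,3)[OF sC(2)]
    ds_emb_add[OF B] ds_emb_scale[OF B] ds_emb_add[OF C] ds_emb_scale[OF C]
  {
    assume \<xi>: "\<And>j. j \<in> J \<Longrightarrow> \<xi> j \<in> forms B 1"
      and \<omega>: "fst \<omega> = (\<Sum>j\<in>J. pure_tensor (fscal B) (scal C) (\<xi> j) (c' j))"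
    have 1: "bilinear_on (fscal B) (scal C) tscale (forms B 1) UNIV
        (\<lambda>\<xi> c'. pure_tensor (fscal B) (scal C) (emb B b * \<xi>) (c * c'))" for b c
      by (rule bilinear_onI) (simp_all add: distrib_left alg pure_tensor_simps)
    have 2: "bilinear_on (scal B) (scal C) tscale UNIV UNIV
        (\<lambda>b c. \<Sum>j\<in>J. pure_tensor (fscal B) (scal C) (emb B b * \<xi> j) (c * c' j))"
      by (rule bilinear_onI) (simp_all add: distrib_right alg pure_tensor_simps sum.distrib tscale_sum)
    show "fst (tensor_act B C t \<omega>)
        = (\<Sum>i\<in>I. \<Sum>j\<in>J. pure_tensor (fscal B) (scal C) (emb B (b i) * \<xi> j) (c i * c' j))"
      by (simp add: tensor_act_def t \<omega> \<xi> tensor_lift_sum[OF vs(2,3,5) ds_subspace[OF B] subspace_UNIV[OF vs(3)] 1]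
          tensor_lift_sum_UNIV[OF vs(1,3,5) 2] del: One_nat_def)
  }
  {
    assume \<eta>: "\<And>j. j \<in> J \<Longrightarrow> \<eta> j \<in> forms C 1"
      and \<omega>: "snd \<omega> = (\<Sum>j\<in>J. pure_tensor (scal B) (fscal C) (b' j) (\<eta> j))"
    have 1: "bilinear_on (scal B) (fscal C) tscale UNIV (forms C 1)
        (\<lambda>b' \<eta>. pure_tensor (scal B) (fscal C) (b * b') (emb C c * \<eta>))" for b c
      by (rule bilinear_onI) (simp_all add: distrib_left alg pure_tensor_simps)
    have 2: "bilinear_on (scal B) (scal C) tscale UNIV UNIV
        (\<lambda>b c. \<Sum>j\<in>J. pure_tensor (scal B) (fscal C) (b * b' j) (emb C c * \<eta> j))"
      by (rule bilinear_onI) (simp_all add: distrib_right alg pure_tensor_simps sum.distrib tscale_sum)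
    show "snd (tensor_act B C t \<omega>)
        = (\<Sum>i\<in>I. \<Sum>j\<in>J. pure_tensor (scal B) (fscal C) (b i * b' j) (emb C (c i) * \<eta> j))"
      by (simp add: tensor_act_def t \<omega> \<eta> tensor_lift_sum[OF vs(1,4,5) subspace_UNIV[OF vs(1)] ds_subspace[OF C] 1]
          tensor_lift_sum_UNIV[OF vs(1,3,5) 2] del: One_nat_def)
  }
qed

text \<open>Generators \<open>a da'\<close> are the only one-forms at which a pushforward is given
  by a formula; all others are reached by linearity.\<close>

lemma pushforward_sum:
  assumes B: "differential_structure B" and C: "differential_structure C"
    and g: "is_pushforward A tensor_forms_scale (tensor_act B C) (tensor_diff B C) f g"
    and fa: "f a = (\<Sum>i\<in>I. pure_tensor (scal B) (scal C) (b i) (c i))"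
    and fa': "f a' = (\<Sum>j\<in>J. pure_tensor (scal B) (scal C) (b' j) (c' j))"
  shows fst_pushforward_sum: "fst (g (emb A a * diff A (emb A a'))) = (\<Sum>i\<in>I. \<Sum>j\<in>J.
      pure_tensor (fscal B) (scal C) (emb B (b i) * diff B (emb B (b' j))) (c i * c' j))"
    and snd_pushforward_sum: "snd (g (emb A a * diff A (emb A a'))) = (\<Sum>i\<in>I. \<Sum>j\<in>J.
      pure_tensor (scal B) (fscal C) (b i * b' j) (emb C (c i) * diff C (emb C (c' j))))"
proof -
  note vs = ds_scal[OF B, THEN unital_algebraD(1)] ds_scal[OF C, THEN unital_algebraD(1)] vector_space_tscale
  have 1: "bilinear_on (scal B) (scal C) tscale UNIV UNIV
       (\<lambda>b c. pure_tensor (fscal B) (scal C) (diff B (emb B b)) c)"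
    by (rule bilinear_onI) (simp_all add: pure_tensor_simps ds_emb_add[OF B] ds_emb_scale[OF B]
        ds_diff_add[OF B] ds_diff_scale[OF B])
  have 2: "bilinear_on (scal B) (scal C) tscale UNIV UNIV
       (\<lambda>b c. pure_tensor (scal B) (fscal C) b (diff C (emb C c)))"
    by (rule bilinear_onI) (simp_all add: pure_tensor_simps ds_emb_add[OF C] ds_emb_scale[OF C]
        ds_diff_add[OF C] ds_diff_scale[OF C])
  have "g (emb A a * diff A (emb A a')) = tensor_act B C (f a) (tensor_diff B C (f a'))"
    using g by (simp add: is_pushforward_def)
  moreover have "tensor_diff B C (f a') =
      ((\<Sum>j\<in>J. pure_tensor (fscal B) (scal C) (diff B (emb B (b' j))) (c' j)),
       (\<Sum>j\<in>J. pure_tensor (scal B) (fscal C) (b' j) (diff C (emb C (c' j)))))"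
    unfolding tensor_diff_def fa' tensor_lift_sum_UNIV[OF vs 1] tensor_lift_sum_UNIV[OF vs 2] ..
  ultimately show "fst (g (emb A a * diff A (emb A a'))) = (\<Sum>i\<in>I. \<Sum>j\<in>J.
      pure_tensor (fscal B) (scal C) (emb B (b i) * diff B (emb B (b' j))) (c i * c' j))"
    "snd (g (emb A a * diff A (emb A a'))) = (\<Sum>i\<in>I. \<Sum>j\<in>J.
      pure_tensor (scal B) (fscal C) (b i * b' j) (emb C (c i) * diff C (emb C (c' j))))"
    using fst_tensor_act_sum[OF B C fa, of J "\<lambda>j. diff B (emb B (b' j))" "tensor_diff B C (f a')" c']
      snd_tensor_act_sum[OF B C fa, of J "\<lambda>j. diff C (emb C (c' j))" "tensor_diff B C (f a')" b']
    by (simp_all add: ds_diff_emb[OF B] ds_diff_emb[OF C] del: One_nat_def)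
qed

lemma is_pushforward_pushforward:
  assumes "differentiable_to_tensor A B C f"
  shows "is_pushforward A tensor_forms_scale (tensor_act B C) (tensor_diff B C) f (pushforward A B C f)"
  using assms unfolding differentiable_to_tensor_def pushforward_def by (rule someI_ex)

lemma generated_field_sum:
  assumes H: "differential_structure H" and M: "differential_structure M"
    and \<rho>: "differentiable_to_tensor M H M \<rho>" and \<alpha>: "\<alpha> \<in> braided_lie_algebra H \<epsilon>"
    and "\<rho> a = (\<Sum>i\<in>I. pure_tensor (scal H) (scal M) (h i) (m i))"
    and "\<rho> a' = (\<Sum>j\<in>J. pure_tensor (scal H) (scal M) (h' j) (m' j))"
  shows "generated_field H M \<rho> \<alpha> (emb M a * diff M (emb M a'))
    = (\<Sum>i\<in>I. \<Sum>j\<in>J. scal M (\<alpha> (emb H (h i) * diff H (emb H (h' j)))) (m i * m' j))"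
proof -
  note vs = ds_fscal[OF H, THEN unital_algebraD(1)] ds_scal[OF M, THEN unital_algebraD(1)]
    ds_scal[OF M, THEN unital_algebraD(1)]
  have "linear_on (fscal H) (*) (forms H 1) \<alpha>" using \<alpha> by (simp add: braided_lie_algebra_def)
  note bil = bilinear_on_scaled[OF vs(1,2) this, of UNIV]
  note sub = ds_subspace[OF H, of 1] subspace_UNIV[OF vs(2)]
  note lin = linear_on_sum[OF vector_space_tscale vs(3) tensor_universal(1)[OF vs sub bil] subspace_tensor_space]
  show ?thesis
    unfolding generated_field_def fst_pushforward_sum[where f = \<rho>, OF H M is_pushforward_pushforward[OF \<rho>] assms(5,6)]
    by (subst lin, intro sum_pure_in_tensor_space,
        auto intro!: ds_left_mult[OF H] ds_diff_emb[OF H] sum.cong tensor_lift_sum[OF vs sub bil]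
          simp del: One_nat_def)
qed

lemma left_field_sum:
  assumes H: "differential_structure H"
    and \<Delta>: "differentiable_to_tensor H H H \<Delta>" and \<alpha>: "\<alpha> \<in> braided_lie_algebra H \<epsilon>"
    and "\<Delta> a = (\<Sum>i\<in>I. pure_tensor (scal H) (scal H) (b i) (c i))"
    and "\<Delta> a' = (\<Sum>j\<in>J. pure_tensor (scal H) (scal H) (b' j) (c' j))"
  shows "left_field H \<Delta> \<alpha> (emb H a * diff H (emb H a'))
    = (\<Sum>i\<in>I. \<Sum>j\<in>J. scal H (\<alpha> (emb H (c i) * diff H (emb H (c' j)))) (b i * b' j))"
proof -
  note vs = ds_scal[OF H, THEN unital_algebraD(1)] ds_fscal[OF H, THEN unital_algebraD(1)]
    ds_scal[OF H, THEN unital_algebraD(1)]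
  have "linear_on (fscal H) (*) (forms H 1) \<alpha>" using \<alpha> by (simp add: braided_lie_algebra_def)
  note bil = bilinear_on_scaled_right[OF vs(1,2) this, of UNIV]
  note sub = subspace_UNIV[OF vs(1)] ds_subspace[OF H, of 1]
  note lin = linear_on_sum[OF vector_space_tscale vs(3) tensor_universal(1)[OF vs sub bil] subspace_tensor_space]
  show ?thesis
    unfolding left_field_def snd_pushforward_sum[where f = \<Delta>, OF H H is_pushforward_pushforward[OF \<Delta>] assms(4,5)]
    by (subst lin, intro sum_pure_in_tensor_space,
        auto intro!: ds_left_mult[OF H] ds_diff_emb[OF H] sum.cong tensor_lift_sum[OF vs sub bil]
          simp del: One_nat_def)
qed

text \<open>\<open>is_pushforward\<close> does not constrain the range of \<open>g\<close>, while
  the \<open>tensor_lift\<close> in \<open>generated_field\<close> is linear only on genuine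
  tensors. Values on generators are genuine tensors, and linearity spreads this over all
  one-forms.\<close>

lemma pushforward_in_tensor_space:
  assumes A: "differential_structure A" and B: "differential_structure B" and C: "differential_structure C"
    and g: "is_pushforward A tensor_forms_scale (tensor_act B C) (tensor_diff B C) f g"
    and f: "range f \<subseteq> tensor_space (scal B) (scal C) UNIV UNIV"
    and \<xi>: "\<xi> \<in> forms A 1"
  shows "fst (g \<xi>) \<in> tensor_space (fscal B) (scal C) (forms B 1) UNIV"
proof -
  let ?TS = "tensor_space (fscal B) (scal C) (forms B 1) UNIV"
  interpret A: vector_space "fscal A" using ds_fscal[OF A] by (rule unital_algebraD)
  have lin: "linear_on (fscal A) tensor_forms_scale (forms A 1) g"
    using g by (simp add: is_pushforward_def)
  have sub: "A.subspace (forms A 1)" by (rule ds_subspace[OF A])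
  note T = vector_space_tscale[folded module_iff_vector_space]
  note TS = subspace_tensor_space[of "fscal B" "scal C" "forms B 1" UNIV]
  have gen: "fst (g (emb A a * diff A (emb A a'))) \<in> ?TS" for a a'
  proof -
    note vs = ds_scal[OF B, THEN unital_algebraD(1)]
    obtain n :: nat and b c where 1: "f a = (\<Sum>i<n. pure_tensor (scal B) (scal C) (b i) (c i))"
      by (rule range_tensor_space_obtains_sum[OF vs f])
    obtain n' :: nat and b' c' where 2: "f a' = (\<Sum>i<n'. pure_tensor (scal B) (scal C) (b' i) (c' i))"
      by (rule range_tensor_space_obtains_sum[OF vs f])
    show ?thesis unfolding fst_pushforward_sum[where f = f, OF B C g 1 2]
      by (intro module.subspace_sum[OF T TS] sum_pure_in_tensor_space ds_left_mult[OF B] ds_diff_emb[OF B] UNIV_I)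
  qed
  \<comment> \<open>Membership in \<open>forms A 1\<close> is carried along since \<open>g\<close>
    is additive only there.\<close>
  have "\<xi> \<in> forms A 1 \<and> fst (g \<xi>) \<in> ?TS"
  proof (rule A.span_induct_alt[where h = "\<lambda>\<xi>. \<xi> \<in> forms A 1 \<and> fst (g \<xi>) \<in> ?TS"])
    show "\<xi> \<in> A.span {emb A b * diff A (emb A b') |b b'. True}" using \<xi> by (simp only: ds_span[OF A])
    have "g (fscal A 0 0) = tensor_forms_scale 0 (g 0)"
      by (rule linear_on_scale[OF lin A.subspace_0[OF sub]])
    then have "fst (g 0) = tscale 0 (fst (g 0))"
      by (metis A.scale_zero_right fst_map_prod tensor_forms_scale_def)
    then have "fst (g 0) = 0" by (simp only: module.scale_zero_left[OF T])
    then show "0 \<in> forms A 1 \<and> fst (g 0) \<in> ?TS"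
      using A.subspace_0[OF sub] module.subspace_0[OF T TS] by simp
  next
    fix c x y
    assume "x \<in> {emb A b * diff A (emb A b') |b b'. True}" and y: "y \<in> forms A 1 \<and> fst (g y) \<in> ?TS"
    then have x: "x \<in> forms A 1" "fst (g x) \<in> ?TS"
      using gen ds_left_mult[OF A ds_diff_emb[OF A]] by auto
    have cx: "fscal A c x \<in> forms A 1" using x(1) by (rule A.subspace_scale[OF sub])
    have "fst (g (fscal A c x + y)) = tscale c (fst (g x)) + fst (g y)"
      using y by (simp add: linear_on_add[OF lin cx] linear_on_scale[OF lin x(1)] tensor_forms_scale_def)
    then show "fscal A c x + y \<in> forms A 1 \<and> fst (g (fscal A c x + y)) \<in> ?TS"
      using y x cx by (simp add: A.subspace_add[OF sub] module.subspace_add[OF T TS] module.subspace_scale[OF T TS]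
          del: One_nat_def)
  qed
  then show ?thesis by simp
qed

section \<open>Operators on comodules\<close>

text \<open>Coassociativity in Sweedler form: a trilinear \<open>f\<close> may be evaluated after
  splitting either leg of \<open>\<rho> m\<close>. Taking \<open>\<rho> = \<Delta>\<close> covers
  the coalgebra itself.\<close>

lemma coassociative_sum:
  assumes vs: "vector_space s" "vector_space sM" "vector_space sz"
    and \<Delta>: "range \<Delta> \<subseteq> tensor_space s s UNIV UNIV" "linear_on s tscale UNIV \<Delta>"
    and \<rho>: "range \<rho> \<subseteq> tensor_space s sM UNIV UNIV" "linear_on sM tscale UNIV \<rho>"
    and coassoc: "tensor_assoc s s sM (tensor_lift s sM tscale UNIV UNIV (\<lambda>h n. pure_tensor tscale sM (\<Delta> h) n) (\<rho> m))
         = tensor_lift s sM tscale UNIV UNIV (\<lambda>h n. pure_tensor s tscale h (\<rho> n)) (\<rho> m)"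
    and m: "\<rho> m = (\<Sum>i<n::nat. pure_tensor s sM (h i) (x i))"
    and f: "\<And>u. bilinear_on s sM sz UNIV UNIV (f u)" "\<And>v w. linear_on s sz UNIV (\<lambda>u. f u v w)"
  shows "(\<Sum>i<n. tensor_lift s s sz UNIV UNIV (\<lambda>u v. f u v (x i)) (\<Delta> (h i)))
    = (\<Sum>i<n. tensor_lift s sM sz UNIV UNIV (f (h i)) (\<rho> (x i)))"
proof (rule tensor_assoc_trilinear[OF vs(1,1,2,3) _ _ _ f])
  show "\<Delta> (h i) \<in> tensor_space s s UNIV UNIV" "\<rho> (x i) \<in> tensor_space s sM UNIV UNIV" for i
    using \<Delta>(1) \<rho>(1) by auto
  have 1: "bilinear_on s sM tscale UNIV UNIV (\<lambda>h n. pure_tensor tscale sM (\<Delta> h) n)"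
    by (rule bilinear_onI) (simp_all add: linear_on_add[OF \<Delta>(2)] linear_on_scale[OF \<Delta>(2)] pure_tensor_simps)
  have 2: "bilinear_on s sM tscale UNIV UNIV (\<lambda>h n. pure_tensor s tscale h (\<rho> n))"
    by (rule bilinear_onI) (simp_all add: linear_on_add[OF \<rho>(2)] linear_on_scale[OF \<rho>(2)] pure_tensor_simps)
  show "tensor_assoc s s sM (\<Sum>i<n. pure_tensor tscale sM (\<Delta> (h i)) (x i))
    = (\<Sum>i<n. pure_tensor s tscale (h i) (\<rho> (x i)))"
    using coassoc unfolding m tensor_lift_sum_UNIV[OF vs(1,2) vector_space_tscale 1]
      tensor_lift_sum_UNIV[OF vs(1,2) vector_space_tscale 2] .
qed

lemma linear_on_tensor_lift_comp:
  assumes "vector_space s1" "vector_space s2" "vector_space s3" "bilinear_on s1 s2 s3 UNIV UNIV f"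
    and "range \<rho> \<subseteq> tensor_space s1 s2 UNIV UNIV" "linear_on s tscale UNIV \<rho>"
  shows "linear_on s s3 UNIV (\<lambda>m. tensor_lift s1 s2 s3 UNIV UNIV f (\<rho> m))"
proof -
  have \<rho>: "\<rho> m \<in> tensor_space s1 s2 UNIV UNIV" for m using assms(5) by auto
  note lin = tensor_lift_linear_UNIV[OF assms(1-4)]
  show ?thesis
    unfolding linear_on_def
    by (simp add: linear_on_add[OF assms(6)] linear_on_scale[OF assms(6)]
        linear_on_add[OF lin \<rho> \<rho>] linear_on_scale[OF lin \<rho>])
qed

lemma linear_on_funpow: "linear_on s s UNIV L \<Longrightarrow> linear_on s s UNIV (L ^^ r)"
  by (induction r) (simp_all add: linear_on_def)

section \<open>Powers of the operators on a coalgebra and on a comodule\<close>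

locale coalgebra =
  fixes s :: "'k::field \<Rightarrow> 'h::ab_group_add \<Rightarrow> 'h" and \<Delta> :: "'h \<Rightarrow> ('k, 'h, 'h) tensor" and \<epsilon> :: "'h \<Rightarrow> 'k"
  assumes vs: "vector_space s"
    and comult: "range \<Delta> \<subseteq> tensor_space s s UNIV UNIV" "linear_on s tscale UNIV \<Delta>"
    and counit: "linear_on s (*) UNIV \<epsilon>"
    and coassoc: "tensor_assoc s s s (tensor_lift s s tscale UNIV UNIV (\<lambda>a b. pure_tensor tscale s (\<Delta> a) b) (\<Delta> h))
         = tensor_lift s s tscale UNIV UNIV (\<lambda>a b. pure_tensor s tscale a (\<Delta> b)) (\<Delta> h)"
    and counit_right: "tensor_lift s s s UNIV UNIV (\<lambda>a b. s (\<epsilon> b) a) (\<Delta> h) = h"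
begin

definition invariant_op :: "('h \<Rightarrow> 'k) \<Rightarrow> 'h \<Rightarrow> 'h"
  where "invariant_op a h = tensor_lift s s s UNIV UNIV (\<lambda>u v. s (a v) u) (\<Delta> h)"

lemma comult_obtains_sum:
  obtains n :: nat and u v where "\<Delta> h = (\<Sum>i<n. pure_tensor s s (u i) (v i))"
  by (rule range_tensor_space_obtains_sum[OF vs comult(1)])

lemma invariant_op_sum:
  assumes "linear_on s (*) UNIV a" "\<Delta> h = (\<Sum>i\<in>I. pure_tensor s s (u i) (v i))"
  shows "invariant_op a h = (\<Sum>i\<in>I. s (a (v i)) (u i))"
  unfolding invariant_op_def assms(2)
  by (rule tensor_lift_sum_UNIV[OF vs vs vs bilinear_on_scaled_right[OF vs vs assms(1)]])

lemma linear_invariant_op: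
  "linear_on s (*) UNIV a \<Longrightarrow> linear_on s s UNIV (invariant_op a)"
  unfolding invariant_op_def[abs_def]
  by (intro linear_on_tensor_lift_comp vs bilinear_on_scaled_right comult)

lemma linear_counit_funpow:
  assumes "linear_on s (*) UNIV a"
  shows "linear_on s (*) UNIV (\<lambda>h. \<epsilon> ((invariant_op a ^^ r) h))"
  using linear_on_funpow[OF linear_invariant_op[OF assms], of r] counit by (simp add: linear_on_def)

text \<open>The functional \<open>\<epsilon>L^r\<close>, called \<open>e r\<close> in the proof, is
  the \<open>r\<close>-th convolution power of \<open>a\<close>: \<open>e (Suc r)\<close> is the
  convolution of \<open>e r\<close> with \<open>a\<close>. The case \<open>r = 0\<close> is the
  right counit law.\<close>

lemma invariant_op_funpow:
  assumes a: "linear_on s (*) UNIV a"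
  shows "(invariant_op a ^^ r) h = invariant_op (\<lambda>k. \<epsilon> ((invariant_op a ^^ r) k)) h"
proof (induction r arbitrary: h)
  case 0
  show ?case by (simp add: invariant_op_def counit_right)
next
  case (Suc r)
  interpret V: vector_space s by (rule vs)
  let ?L = "invariant_op a"
  define e where "e r k = \<epsilon> ((?L ^^ r) k)" for r k
  have e: "linear_on s (*) UNIV (e r)" for r
    unfolding e_def[abs_def] by (rule linear_counit_funpow[OF a])
  note pow = linear_on_funpow[OF linear_invariant_op[OF a]]
  obtain n :: nat and u v where h: "\<Delta> h = (\<Sum>i<n. pure_tensor s s (u i) (v i))"
    by (rule comult_obtains_sum)
  \<comment> \<open>Evaluated on the three legs of the iterated coproduct. Grouping the first two
    legs recovers \<open>L^r\<close>; grouping the last two convolves \<open>e r\<close> with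
    \<open>a\<close>.\<close>
  define f where "f x y z = s (e r y * a z) x" for x y z
  have f1: "bilinear_on s s s UNIV UNIV (f x)" for x
    by (rule bilinear_onI) (simp_all add: f_def linear_on_add[OF a] linear_on_scale[OF a]
        linear_on_add[OF e] linear_on_scale[OF e] algebra_simps V.scale_left_distrib)
  have f2: "linear_on s s UNIV (\<lambda>x. f x y z)" for y z
    by (simp add: linear_on_def f_def V.scale_right_distrib mult.commute mult.left_commute)
  have f3: "bilinear_on s s s UNIV UNIV (\<lambda>x y. f x y z)" for z
    using f1 f2 by (simp add: bilinear_on_def linear_on_def)
  \<comment> \<open>The innermost \<open>L\<close> is split off, so the induction hypothesis is
    applied to the left legs \<open>u i\<close>; hence \<open>h\<close> is kept arbitrary.\<close>
  have "(?L ^^ Suc r) h = (?L ^^ r) (?L h)" by (simp add: funpow_swap1)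
  also have "\<dots> = (\<Sum>i<n. s (a (v i)) ((?L ^^ r) (u i)))"
    by (simp add: invariant_op_sum[OF a h] linear_on_sum[OF vs vs pow subspace_UNIV[OF vs]] linear_on_scale[OF pow])
  also have "\<dots> = (\<Sum>i<n. tensor_lift s s s UNIV UNIV (\<lambda>x y. f x y (v i)) (\<Delta> (u i)))"
  proof (rule sum.cong)
    fix i
    obtain m :: nat and x y where ui: "\<Delta> (u i) = (\<Sum>j<m. pure_tensor s s (x j) (y j))"
      by (rule comult_obtains_sum)
    have "(?L ^^ r) (u i) = (\<Sum>j<m. s (e r (y j)) (x j))"
      using Suc[of "u i"] invariant_op_sum[OF e ui, of r] by (simp add: e_def[abs_def])
    then show "s (a (v i)) ((?L ^^ r) (u i)) = tensor_lift s s s UNIV UNIV (\<lambda>x y. f x y (v i)) (\<Delta> (u i))"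
      unfolding ui tensor_lift_sum_UNIV[OF vs vs vs f3] by (simp add: f_def V.scale_sum_right mult.commute)
  qed simp
  also have "\<dots> = (\<Sum>i<n. tensor_lift s s s UNIV UNIV (f (u i)) (\<Delta> (v i)))"
    by (rule coassociative_sum[OF vs vs vs comult comult coassoc h f1 f2])
  also have "\<dots> = (\<Sum>i<n. s (e (Suc r) (v i)) (u i))"
  proof (rule sum.cong)
    fix i
    obtain m :: nat and x y where vi: "\<Delta> (v i) = (\<Sum>j<m. pure_tensor s s (x j) (y j))"
      by (rule comult_obtains_sum)
    have "e (Suc r) (v i) = e r (?L (v i))" by (simp add: e_def funpow_swap1)
    also have "\<dots> = (\<Sum>j<m. a (y j) * e r (x j))"
      by (simp add: invariant_op_sum[OF a vi] linear_on_sum[OF vs vector_space_field e subspace_UNIV[OF vs]]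
          linear_on_scale[OF e])
    finally show "tensor_lift s s s UNIV UNIV (f (u i)) (\<Delta> (v i)) = s (e (Suc r) (v i)) (u i)"
      by (simp add: vi tensor_lift_sum_UNIV[OF vs vs vs f1] f_def V.scale_sum_left mult.commute)
  qed simp
  also have "\<dots> = invariant_op (e (Suc r)) h" by (rule invariant_op_sum[OF e h, symmetric])
  finally show ?case by (simp add: e_def[abs_def])
qed

lemma invariant_op_locally_finite:
  assumes a: "linear_on s (*) UNIV a"
  shows "\<exists>B. finite B \<and> (\<forall>r. (invariant_op a ^^ r) h \<in> module.span s B)"
proof -
  interpret V: vector_space s by (rule vs)
  obtain n :: nat and u v where h: "\<Delta> h = (\<Sum>i<n. pure_tensor s s (u i) (v i))"
    by (rule comult_obtains_sum)
  have "(invariant_op a ^^ r) h \<in> V.span (u ` {..<n})" for r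
    unfolding invariant_op_funpow[OF a, of r h] invariant_op_sum[OF linear_counit_funpow[OF a] h]
    by (intro V.span_sum V.span_scale V.span_base) simp
  then show ?thesis by (intro exI[of _ "u ` {..<n}"]) simp
qed

end

locale left_comodule = coalgebra s \<Delta> \<epsilon>
  for s :: "'k::field \<Rightarrow> 'h::ab_group_add \<Rightarrow> 'h" and \<Delta> \<epsilon> +
  fixes sM :: "'k \<Rightarrow> 'm::ab_group_add \<Rightarrow> 'm" and \<rho> :: "'m \<Rightarrow> ('k, 'h, 'm) tensor"
  assumes vsM: "vector_space sM"
    and coaction: "range \<rho> \<subseteq> tensor_space s sM UNIV UNIV" "linear_on sM tscale UNIV \<rho>"
    and coaction_assoc: "tensor_assoc s s sM (tensor_lift s sM tscale UNIV UNIV (\<lambda>h n. pure_tensor tscale sM (\<Delta> h) n) (\<rho> m))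
         = tensor_lift s sM tscale UNIV UNIV (\<lambda>h n. pure_tensor s tscale h (\<rho> n)) (\<rho> m)"
    and coaction_counit: "tensor_lift s sM sM UNIV UNIV (\<lambda>h n. sM (\<epsilon> h) n) (\<rho> m) = m"
begin

definition coaction_op :: "('h \<Rightarrow> 'k) \<Rightarrow> 'm \<Rightarrow> 'm"
  where "coaction_op a m = tensor_lift s sM sM UNIV UNIV (\<lambda>h n. sM (a h) n) (\<rho> m)"

lemma coaction_obtains_sum:
  obtains n :: nat and h x where "\<rho> m = (\<Sum>i<n. pure_tensor s sM (h i) (x i))"
  by (rule range_tensor_space_obtains_sum[OF vs coaction(1)])

lemma coaction_op_sum:
  assumes "linear_on s (*) UNIV a" "\<rho> m = (\<Sum>i\<in>I. pure_tensor s sM (h i) (x i))"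
  shows "coaction_op a m = (\<Sum>i\<in>I. sM (a (h i)) (x i))"
  unfolding coaction_op_def assms(2)
  by (rule tensor_lift_sum_UNIV[OF vs vsM vsM bilinear_on_scaled[OF vs vsM assms(1)]])

lemma linear_coaction_op:
  "linear_on s (*) UNIV a \<Longrightarrow> linear_on sM sM UNIV (coaction_op a)"
  unfolding coaction_op_def[abs_def]
  by (intro linear_on_tensor_lift_comp vs vsM bilinear_on_scaled coaction)

text \<open>The outermost operator is split off here, so the induction hypothesis is used at
  \<open>m\<close> itself. The new operator splits the legs \<open>x i\<close>; coassociativity
  moves the splitting to the legs \<open>h i\<close>, where it convolves \<open>e r\<close> with
  \<open>a\<close>.\<close>

lemma coaction_op_funpow:
  assumes a: "linear_on s (*) UNIV a"
  shows "(coaction_op a ^^ r) m = coaction_op (\<lambda>h. \<epsilon> ((invariant_op a ^^ r) h)) m"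
proof (induction r)
  case 0
  show ?case by (simp add: coaction_op_def coaction_counit)
next
  case (Suc r)
  interpret V: vector_space s by (rule vs)
  interpret M: vector_space sM by (rule vsM)
  let ?L = "invariant_op a" and ?D = "coaction_op a"
  define e where "e r k = \<epsilon> ((?L ^^ r) k)" for r k
  have e: "linear_on s (*) UNIV (e r)" for r
    unfolding e_def[abs_def] by (rule linear_counit_funpow[OF a])
  note D = linear_coaction_op[OF a]
  obtain n :: nat and h x where m: "\<rho> m = (\<Sum>i<n. pure_tensor s sM (h i) (x i))"
    by (rule coaction_obtains_sum)
  define f where "f u v w = sM (e r u * a v) w" for u v w
  have f1: "bilinear_on s sM sM UNIV UNIV (f u)" for u
    by (rule bilinear_onI) (simp_all add: f_def linear_on_add[OF a] linear_on_scale[OF a]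
        algebra_simps M.scale_left_distrib M.scale_right_distrib)
  have f2: "linear_on s sM UNIV (\<lambda>u. f u v w)" for v w
    by (simp add: linear_on_def f_def linear_on_add[OF e] linear_on_scale[OF e]
        algebra_simps M.scale_left_distrib)
  have f3: "bilinear_on s s sM UNIV UNIV (\<lambda>u v. f u v w)" for w
    using f1 f2 by (simp add: bilinear_on_def linear_on_def)
  have "(?D ^^ Suc r) m = ?D (\<Sum>i<n. sM (e r (h i)) (x i))"
    using Suc coaction_op_sum[OF e m, of r] by (simp add: e_def[abs_def])
  also have "\<dots> = (\<Sum>i<n. sM (e r (h i)) (?D (x i)))"
    by (simp add: linear_on_sum[OF vsM vsM D subspace_UNIV[OF vsM]] linear_on_scale[OF D])
  also have "\<dots> = (\<Sum>i<n. tensor_lift s sM sM UNIV UNIV (f (h i)) (\<rho> (x i)))"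
  proof (rule sum.cong)
    fix i
    obtain n' :: nat and v w where xi: "\<rho> (x i) = (\<Sum>j<n'. pure_tensor s sM (v j) (w j))"
      by (rule coaction_obtains_sum)
    show "sM (e r (h i)) (?D (x i)) = tensor_lift s sM sM UNIV UNIV (f (h i)) (\<rho> (x i))"
      by (simp add: coaction_op_sum[OF a xi] xi tensor_lift_sum_UNIV[OF vs vsM vsM f1] f_def M.scale_sum_right)
  qed simp
  also have "\<dots> = (\<Sum>i<n. tensor_lift s s sM UNIV UNIV (\<lambda>u v. f u v (x i)) (\<Delta> (h i)))"
    by (rule coassociative_sum[OF vs vsM vsM comult coaction coaction_assoc m f1 f2, symmetric])
  also have "\<dots> = (\<Sum>i<n. sM (e (Suc r) (h i)) (x i))"
  proof (rule sum.cong)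
    fix i
    obtain n' :: nat and u v where hi: "\<Delta> (h i) = (\<Sum>j<n'. pure_tensor s s (u j) (v j))"
      by (rule comult_obtains_sum)
    have "e (Suc r) (h i) = e r (?L (h i))" by (simp add: e_def funpow_swap1)
    also have "\<dots> = (\<Sum>j<n'. a (v j) * e r (u j))"
      by (simp add: invariant_op_sum[OF a hi] linear_on_sum[OF vs vector_space_field e subspace_UNIV[OF vs]]
          linear_on_scale[OF e])
    finally show "tensor_lift s s sM UNIV UNIV (\<lambda>u v. f u v (x i)) (\<Delta> (h i)) = sM (e (Suc r) (h i)) (x i)"
      unfolding hi tensor_lift_sum_UNIV[OF vs vs vsM f3] by (simp add: f_def M.scale_sum_left mult.commute)
  qed simp
  also have "\<dots> = coaction_op (e (Suc r)) m" by (rule coaction_op_sum[OF e m, symmetric])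
  finally show ?case by (simp add: e_def[abs_def])
qed

lemma coaction_op_locally_finite:
  assumes a: "linear_on s (*) UNIV a"
  shows "\<exists>B. finite B \<and> (\<forall>r. (coaction_op a ^^ r) m \<in> module.span sM B)"
proof -
  interpret M: vector_space sM by (rule vsM)
  obtain n :: nat and h x where m: "\<rho> m = (\<Sum>i<n. pure_tensor s sM (h i) (x i))"
    by (rule coaction_obtains_sum)
  have "(coaction_op a ^^ r) m \<in> M.span (x ` {..<n})" for r
    unfolding coaction_op_funpow[OF a, of r m] coaction_op_sum[OF linear_counit_funpow[OF a] m]
    by (intro M.span_sum M.span_scale M.span_base) simp
  then show ?thesis by (intro exI[of _ "x ` {..<n}"]) simp
qed

end

section \<open>Summing the exponential series over complete normed scalars\<close>

locale normed_left_comodule = left_comodule s \<Delta> \<epsilon> sM \<rho>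
  for s :: "'k::{real_normed_field,banach} \<Rightarrow> 'h::ab_group_add \<Rightarrow> 'h" and \<Delta> \<epsilon>
    and sM :: "'k \<Rightarrow> 'm::ab_group_add \<Rightarrow> 'm" and \<rho> +
  fixes a :: "'h \<Rightarrow> 'k"
  assumes a: "linear_on s (*) UNIV a"
begin

lemma exp_invariant_op_ex: "\<exists>y. exp_sums s (invariant_op a) h y"
  using invariant_op_locally_finite[OF a, of h] exp_sums_ex[OF vs _ _ linear_invariant_op[OF a]] by blast

lemma exp_coaction_op_ex: "\<exists>y. exp_sums sM (coaction_op a) m y"
  using coaction_op_locally_finite[OF a, of m] exp_sums_ex[OF vsM _ _ linear_coaction_op[OF a]] by blast

text \<open>This becomes \<open>lie_exp\<close> once \<open>invariant_op a\<close> is identified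
  with the Lie derivative along \<open>L_\<alpha>\<close>.\<close>

definition exp_functional :: "'h \<Rightarrow> 'k"
  where "exp_functional h = \<epsilon> (operator_exp s (invariant_op a) h)"

text \<open>The counit is itself a linear functional, so weak convergence of the operator
  exponential applies to it.\<close>

lemma exp_functional_sums: "(\<lambda>r. 1 / fact r * \<epsilon> ((invariant_op a ^^ r) h)) sums exp_functional h"
  unfolding exp_functional_def
  using counit linear_on_UNIV[OF vs vector_space_field]
  by (intro operator_exp_sums vs exp_invariant_op_ex) blast

text \<open>Linearity is inherited by the limit from the terms \<open>\<epsilon>L^r\<close>. It is
  what permits evaluating \<open>coaction_op exp_functional\<close> on an expansion of
  \<open>\<rho> m\<close>.\<close>

lemma linear_exp_functional: "linear_on s (*) UNIV exp_functional"
  unfolding linear_on_def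
proof safe
  note e = linear_counit_funpow[OF a]
  fix x y show "exp_functional (x + y) = exp_functional x + exp_functional y"
    by (rule sums_unique2[OF exp_functional_sums])
      (use sums_add[OF exp_functional_sums[of x] exp_functional_sums[of y]] in
        \<open>simp add: linear_on_add[OF e] distrib_left add_divide_distrib\<close>)
next
  note e = linear_counit_funpow[OF a]
  fix c x show "exp_functional (s c x) = c * exp_functional x"
    by (rule sums_unique2[OF exp_functional_sums])
      (use sums_mult[OF exp_functional_sums[of x], of c] in
        \<open>simp add: linear_on_scale[OF e] mult.left_commute\<close>)
qed

text \<open>One expansion of \<open>\<rho> m\<close> serves all powers \<open>r\<close>. Under a
  functional the series therefore splits into finitely many scalar series with limits
  \<open>exp_functional (h i)\<close>, and only a finite sum is interchanged with the limit.\<close>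

lemma exp_coaction_op: "operator_exp sM (coaction_op a) m = coaction_op exp_functional m"
proof (rule functionals_separate[OF vsM])
  fix \<phi> assume \<phi>: "Vector_Spaces.linear sM (*) \<phi>"
  have \<phi>': "linear_on sM (*) UNIV \<phi>" using \<phi> by (simp add: linear_on_UNIV[OF vsM vector_space_field])
  note e = linear_counit_funpow[OF a]
  note \<phi>_sum = linear_on_sum[OF vsM vector_space_field \<phi>' subspace_UNIV[OF vsM]]
  obtain n :: nat and h x where m: "\<rho> m = (\<Sum>i<n. pure_tensor s sM (h i) (x i))"
    by (rule coaction_obtains_sum)
  have "1 / fact r * \<phi> ((coaction_op a ^^ r) m)
      = (\<Sum>i<n. 1 / fact r * \<epsilon> ((invariant_op a ^^ r) (h i)) * \<phi> (x i))" for r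
    by (simp add: coaction_op_funpow[OF a] coaction_op_sum[OF e m] \<phi>_sum linear_on_scale[OF \<phi>']
        sum_distrib_left sum_divide_distrib mult.assoc)
  moreover have "\<phi> (coaction_op exp_functional m) = (\<Sum>i<n. exp_functional (h i) * \<phi> (x i))"
    by (simp add: coaction_op_sum[OF linear_exp_functional m] \<phi>_sum linear_on_scale[OF \<phi>'])
  ultimately have "(\<lambda>r. 1 / fact r * \<phi> ((coaction_op a ^^ r) m)) sums \<phi> (coaction_op exp_functional m)"
    by (simp only:) (intro sums_sum sums_mult2 exp_functional_sums)
  with operator_exp_sums[OF vsM exp_coaction_op_ex \<phi>]
  show "\<phi> (operator_exp sM (coaction_op a) m) = \<phi> (coaction_op exp_functional m)"
    by (rule sums_unique2)
qed

end

section \<open>The exponential of the generated vector field\<close>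

lemma algebra_map_to_tensorD:
  assumes "algebra_map_to_tensor s s1 s2 f"
  shows "range f \<subseteq> tensor_space s1 s2 UNIV UNIV" "linear_on s tscale UNIV f"
    "f 1 = pure_tensor s1 s2 1 1" "f (x * y) = tensor_mult s1 s2 (f x) (f y)"
  using assms by (auto simp: algebra_map_to_tensor_def)

lemma linear_braided_lie_algebra:
  assumes H: "differential_structure H" and \<alpha>: "\<alpha> \<in> braided_lie_algebra H \<epsilon>"
  shows "linear_on (fscal H) (*) (forms H 1) \<alpha>"
    and "linear_on (scal H) (*) UNIV (\<lambda>h. \<alpha> (diff H (emb H h)))"
proof -
  show \<alpha>_lin: "linear_on (fscal H) (*) (forms H 1) \<alpha>" using \<alpha> by (simp add: braided_lie_algebra_def)
  show "linear_on (scal H) (*) UNIV (\<lambda>h. \<alpha> (diff H (emb H h)))"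
    using linear_on_add[OF \<alpha>_lin] linear_on_scale[OF \<alpha>_lin]
    by (simp add: linear_on_def ds_emb_add[OF H] ds_emb_scale[OF H] ds_diff_add[OF H]
        ds_diff_scale[OF H] ds_diff_emb[OF H] del: One_nat_def)
qed

lemma lie_derivative_generated_field:
  assumes H: "differential_structure H" and M: "differential_structure M"
    and \<rho>: "differentiable_to_tensor M H M \<rho>" and \<alpha>: "\<alpha> \<in> braided_lie_algebra H \<epsilon>"
    and alg: "algebra_map_to_tensor (scal M) (scal H) (scal M) \<rho>"
  shows "lie_derivative M (generated_field H M \<rho> \<alpha>) m = tensor_lift (scal H) (scal M) (scal M) UNIV UNIV
    (\<lambda>h n. scal M (\<alpha> (diff H (emb H h))) n) (\<rho> m)"
proof -
  note vs = ds_scal[OF H, THEN unital_algebraD(1)] ds_scal[OF M, THEN unital_algebraD(1)]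
  obtain n :: nat and h x where m: "\<rho> m = (\<Sum>j<n. pure_tensor (scal H) (scal M) (h j) (x j))"
    by (rule range_tensor_space_obtains_sum[OF vs(1) algebra_map_to_tensorD(1)[OF alg]])
  \<comment> \<open>The form \<open>dm\<close> is read as \<open>1 dm\<close> to match the
    generators on which the pushforward is known; the singleton index set presents
    \<open>1 \<otimes> 1\<close> as a sum.\<close>
  have one: "\<rho> 1 = (\<Sum>i\<in>{()}. pure_tensor (scal H) (scal M) 1 1)"
    using algebra_map_to_tensorD(3)[OF alg] by simp
  from generated_field_sum[OF H M \<rho> \<alpha> one m]
  have "lie_derivative M (generated_field H M \<rho> \<alpha>) m = (\<Sum>j<n. scal M (\<alpha> (diff H (emb H (h j)))) (x j))"
    by (simp add: lie_derivative_def ds_emb_one[OF H] ds_emb_one[OF M])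
  also have "\<dots> = tensor_lift (scal H) (scal M) (scal M) UNIV UNIV
      (\<lambda>h n. scal M (\<alpha> (diff H (emb H h))) n) (\<rho> m)"
    unfolding m by (rule tensor_lift_sum_UNIV[symmetric, OF vs vs(2)
        bilinear_on_scaled[OF vs linear_braided_lie_algebra(2)[OF H \<alpha>]]])
  finally show ?thesis .
qed

lemma lie_derivative_left_field:
  assumes H: "differential_structure H"
    and \<Delta>: "differentiable_to_tensor H H H \<Delta>" and \<alpha>: "\<alpha> \<in> braided_lie_algebra H \<epsilon>"
    and alg: "algebra_map_to_tensor (scal H) (scal H) (scal H) \<Delta>"
  shows "lie_derivative H (left_field H \<Delta> \<alpha>) m = tensor_lift (scal H) (scal H) (scal H) UNIV UNIV
    (\<lambda>h n. scal H (\<alpha> (diff H (emb H n))) h) (\<Delta> m)"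
proof -
  note vs = ds_scal[OF H, THEN unital_algebraD(1)]
  obtain n :: nat and h x where m: "\<Delta> m = (\<Sum>j<n. pure_tensor (scal H) (scal H) (h j) (x j))"
    by (rule range_tensor_space_obtains_sum[OF vs algebra_map_to_tensorD(1)[OF alg]])
  have one: "\<Delta> 1 = (\<Sum>i\<in>{()}. pure_tensor (scal H) (scal H) 1 1)"
    using algebra_map_to_tensorD(3)[OF alg] by simp
  from left_field_sum[OF H \<Delta> \<alpha> one m]
  have "lie_derivative H (left_field H \<Delta> \<alpha>) m = (\<Sum>j<n. scal H (\<alpha> (diff H (emb H (x j)))) (h j))"
    by (simp add: lie_derivative_def ds_emb_one[OF H])
  also have "\<dots> = tensor_lift (scal H) (scal H) (scal H) UNIV UNIV
      (\<lambda>h n. scal H (\<alpha> (diff H (emb H n))) h) (\<Delta> m)"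
    unfolding m by (rule tensor_lift_sum_UNIV[symmetric, OF vs vs vs
        bilinear_on_scaled_right[OF vs vs linear_braided_lie_algebra(2)[OF H \<alpha>]]])
  finally show ?thesis .
qed

section \<open>The right module property of the generated field\<close>

lemma linear_generated_field:
  assumes H: "differential_structure H" and M: "differential_structure M"
    and \<rho>: "differentiable_to_tensor M H M \<rho>" and \<alpha>: "\<alpha> \<in> braided_lie_algebra H \<epsilon>"
    and range: "range \<rho> \<subseteq> tensor_space (scal H) (scal M) UNIV UNIV"
  shows "linear_on (fscal M) (scal M) (forms M 1) (generated_field H M \<rho> \<alpha>)"
proof -
  note vs = ds_fscal[OF H, THEN unital_algebraD(1)] ds_scal[OF M, THEN unital_algebraD(1)]
    ds_scal[OF M, THEN unital_algebraD(1)]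
  note lift = tensor_universal(1)[OF vs ds_subspace[OF H, of 1] subspace_UNIV[OF vs(2)]
      bilinear_on_scaled[OF vs(1,2) linear_braided_lie_algebra(1)[OF H \<alpha>], of UNIV]]
  note push = is_pushforward_pushforward[OF \<rho>]
  have lin: "linear_on (fscal M) tensor_forms_scale (forms M 1) (pushforward M H M \<rho>)"
    using push by (simp add: is_pushforward_def)
  note fst_in = pushforward_in_tensor_space[OF M H M push range]
  show ?thesis
    unfolding linear_on_def generated_field_def
    by (auto simp: linear_on_add[OF lin] linear_on_scale[OF lin] tensor_forms_scale_def
        linear_on_add[OF lift fst_in fst_in] linear_on_scale[OF lift fst_in] simp del: One_nat_def)
qed

text \<open>By Leibniz, \<open>(a db) c = a d(bc) - (ab) dc\<close>, a difference of generators. On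
  legs the same identity in the one-forms of \<open>H\<close> reassembles
  \<open>(h dh') h''\<close>, from which \<open>\<alpha>\<close> extracts
  \<open>\<epsilon>(h'')\<close>; the counit law of the coaction then returns the factor
  \<open>c\<close>.\<close>

lemma generated_field_right_mult_exact:
  assumes H: "differential_structure H" and M: "differential_structure M"
    and \<rho>: "differentiable_to_tensor M H M \<rho>" and \<alpha>: "\<alpha> \<in> braided_lie_algebra H \<epsilon>"
    and alg: "algebra_map_to_tensor (scal M) (scal H) (scal M) \<rho>"
    and counit: "linear_on (scal H) (*) UNIV \<epsilon>"
      "\<And>m. tensor_lift (scal H) (scal M) (scal M) UNIV UNIV (\<lambda>h n. scal M (\<epsilon> h) n) (\<rho> m) = m"
  shows "generated_field H M \<rho> \<alpha> (emb M a * diff M (emb M b) * emb M c)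
    = generated_field H M \<rho> \<alpha> (emb M a * diff M (emb M b)) * c"
proof -
  let ?X = "generated_field H M \<rho> \<alpha>" and ?pt = "pure_tensor (scal H) (scal M)"
  note algM = unital_algebraD[OF ds_scal[OF M]]
  note vs = ds_scal[OF H, THEN unital_algebraD(1)] algM(1)
  interpret M: vector_space "scal M" by (rule vs)
  note \<alpha>_lin = linear_braided_lie_algebra(1)[OF H \<alpha>]
  have \<alpha>_right: "\<alpha> (\<xi> * emb H h) = \<alpha> \<xi> * \<epsilon> h" if "\<xi> \<in> forms H 1" for \<xi> h
    using \<alpha> that by (simp add: braided_lie_algebra_def)
  note obtains_sum = range_tensor_space_obtains_sum[OF vs(1) algebra_map_to_tensorD(1)[OF alg]]
  obtain I :: nat and h m where a: "\<rho> a = (\<Sum>i<I. ?pt (h i) (m i))" by (rule obtains_sum)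
  obtain J :: nat and h' m' where b: "\<rho> b = (\<Sum>i<J. ?pt (h' i) (m' i))" by (rule obtains_sum)
  obtain K :: nat and h'' m'' where c: "\<rho> c = (\<Sum>i<K. ?pt (h'' i) (m'' i))" by (rule obtains_sum)
  note mult = tensor_mult_sum[OF ds_scal[OF H] ds_scal[OF M]]
  \<comment> \<open>Pairs serve as indices because \<open>generated_field_sum\<close> expects one
    index per expansion.\<close>
  have ab: "\<rho> (a * b) = (\<Sum>p\<in>{..<I} \<times> {..<J}. ?pt (h (fst p) * h' (snd p)) (m (fst p) * m' (snd p)))"
    by (simp add: algebra_map_to_tensorD(4)[OF alg] a b mult sum.cartesian_product case_prod_beta)
  have bc: "\<rho> (b * c) = (\<Sum>p\<in>{..<J} \<times> {..<K}. ?pt (h' (fst p) * h'' (snd p)) (m' (fst p) * m'' (snd p)))"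
    by (simp add: algebra_map_to_tensorD(4)[OF alg] b c mult sum.cartesian_product case_prod_beta)
  have c': "c = (\<Sum>k<K. scal M (\<epsilon> (h'' k)) (m'' k))"
    using counit(2)[of c] unfolding c
      tensor_lift_sum_UNIV[OF vs vs(2) bilinear_on_scaled[OF vs counit(1)]] by simp
  note gf = generated_field_sum[OF H M \<rho> \<alpha>]
  note in1 = ds_left_mult[OF M ds_diff_emb[OF M]]
  have "emb M a * diff M (emb M b) * emb M c
      = emb M a * diff M (emb M (b * c)) - emb M (a * b) * diff M (emb M c)"
    by (simp add: ds_emb_mult[OF M] ds_leibniz[OF M] distrib_left mult.assoc)
  then have "?X (emb M a * diff M (emb M b) * emb M c)
      = ?X (emb M a * diff M (emb M (b * c))) - ?X (emb M (a * b) * diff M (emb M c))"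
    using linear_on_diff[OF unital_algebraD(1)[OF ds_fscal[OF M]] vs(2)
        linear_generated_field[OF H M \<rho> \<alpha> algebra_map_to_tensorD(1)[OF alg]] ds_subspace[OF M] in1 in1]
    by simp
  also have "?X (emb M a * diff M (emb M (b * c))) = (\<Sum>i<I. \<Sum>j<J. \<Sum>k<K.
      scal M (\<alpha> (emb H (h i) * diff H (emb H (h' j * h'' k)))) (m i * m' j * m'' k))"
    by (simp add: gf[OF a bc] sum.cartesian_product case_prod_beta mult.assoc)
  also have "?X (emb M (a * b) * diff M (emb M c)) = (\<Sum>i<I. \<Sum>j<J. \<Sum>k<K.
      scal M (\<alpha> (emb H (h i * h' j) * diff H (emb H (h'' k)))) (m i * m' j * m'' k))"
    using sum.cartesian_product[of "\<lambda>i j. \<Sum>k<K. scal M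
        (\<alpha> (emb H (h i * h' j) * diff H (emb H (h'' k)))) (m i * m' j * m'' k)" "{..<J}" "{..<I}"]
    by (simp add: gf[OF ab c] case_prod_beta)
  also have "(\<Sum>i<I. \<Sum>j<J. \<Sum>k<K.
      scal M (\<alpha> (emb H (h i) * diff H (emb H (h' j * h'' k)))) (m i * m' j * m'' k)) - \<dots>
    = (\<Sum>i<I. \<Sum>j<J. \<Sum>k<K.
      scal M (\<alpha> (emb H (h i) * diff H (emb H (h' j))) * \<epsilon> (h'' k)) (m i * m' j * m'' k))"
    unfolding sum_subtractf[symmetric] M.scale_left_diff_distrib[symmetric]
  proof (intro sum.cong refl arg_cong2[where f = "scal M"])
    fix i j k
    note in1 = ds_left_mult[OF H ds_diff_emb[OF H]]
    have "emb H (h i) * diff H (emb H (h' j)) * emb H (h'' k)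
      = emb H (h i) * diff H (emb H (h' j * h'' k)) - emb H (h i * h' j) * diff H (emb H (h'' k))"
      \<comment> \<open>Leibniz again, now read backwards on the legs in \<open>H\<close>.\<close>
      by (simp add: ds_emb_mult[OF H] ds_leibniz[OF H] distrib_left mult.assoc)
    then show "\<alpha> (emb H (h i) * diff H (emb H (h' j * h'' k))) - \<alpha> (emb H (h i * h' j) * diff H (emb H (h'' k)))
      = \<alpha> (emb H (h i) * diff H (emb H (h' j))) * \<epsilon> (h'' k)"
      using linear_on_diff[OF unital_algebraD(1)[OF ds_fscal[OF H]] vector_space_field \<alpha>_lin
          ds_subspace[OF H] in1 in1] \<alpha>_right[OF in1] by metis
  qed
  also have "\<dots> = ?X (emb M a * diff M (emb M b)) * c"
    \<comment> \<open>The factors \<open>\<epsilon> (h'' k)\<close> and \<open>m'' k\<close> combine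
      to \<open>c\<close> by the expansion in the fact \<open>c'\<close>.\<close>
    unfolding gf[OF a b]
    by (subst c', unfold sum_distrib_right, unfold sum_distrib_left) (simp add: algM(2,3) mult.commute)
  finally show ?thesis .
qed

text \<open>Both sides of the module law are linear in the one-form, so it suffices to compare them
  on the spanning forms \<open>b db'\<close>.\<close>

lemma vector_field_generated_field:
  assumes H: "differential_structure H" and M: "differential_structure M"
    and \<rho>: "differentiable_to_tensor M H M \<rho>" and \<alpha>: "\<alpha> \<in> braided_lie_algebra H \<epsilon>"
    and alg: "algebra_map_to_tensor (scal M) (scal H) (scal M) \<rho>"
    and counit: "linear_on (scal H) (*) UNIV \<epsilon>"
      "\<And>m. tensor_lift (scal H) (scal M) (scal M) UNIV UNIV (\<lambda>h n. scal M (\<epsilon> h) n) (\<rho> m) = m"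
  shows "vector_field M (generated_field H M \<rho> \<alpha>)"
proof -
  let ?X = "generated_field H M \<rho> \<alpha>"
  note algM = unital_algebraD[OF ds_scal[OF M]] unital_algebraD(2,3)[OF ds_fscal[OF M]]
  have lin: "linear_on (fscal M) (scal M) (forms M 1) ?X"
    by (rule linear_generated_field[OF H M \<rho> \<alpha> algebra_map_to_tensorD(1)[OF alg]])
  have "?X (\<xi> * emb M c) = ?X \<xi> * c" if \<xi>: "\<xi> \<in> forms M 1" for \<xi> c
  proof (rule linear_on_span_eq[where S = "{emb M b * diff M (emb M b') |b b'. True}",
        OF unital_algebraD(1)[OF ds_fscal[OF M]] algM(1), folded ds_span[OF M]])
    show "\<xi> \<in> forms M 1" by fact
    show "linear_on (fscal M) (scal M) (forms M 1) (\<lambda>\<xi>. ?X (\<xi> * emb M c))"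
      unfolding linear_on_def
      by (auto simp: distrib_right algM linear_on_add[OF lin] linear_on_scale[OF lin]
          ds_right_mult[OF M] simp del: One_nat_def)
    show "linear_on (fscal M) (scal M) (forms M 1) (\<lambda>\<xi>. ?X \<xi> * c)"
      unfolding linear_on_def
      by (auto simp: distrib_right algM linear_on_add[OF lin] linear_on_scale[OF lin] simp del: One_nat_def)
  next
    fix \<xi> assume "\<xi> \<in> {emb M b * diff M (emb M b') |b b'. True}"
    then show "?X (\<xi> * emb M c) = ?X \<xi> * c"
      using generated_field_right_mult_exact[OF assms] by auto
  qed
  with lin show ?thesis by (simp add: vector_field_def)
qed

text \<open>The conjuncts before the equation give it its meaning: \<open>operator_exp\<close>
  denotes a limit only where the series converges, and \<open>tensor_lift\<close> realises
  \<open>exp(\<alpha>) \<otimes> id\<close> only if \<open>lie_exp\<close> is linear.\<close>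

theorem theorem18p9:
  fixes H :: "('k::{real_normed_field,banach}, 'h::{ring,monoid_mult}, 'wh::{ring,monoid_mult}) diff_algebra"
    and M :: "('k, 'm::{ring,monoid_mult}, 'wm::{ring,monoid_mult}) diff_algebra"
    and \<Delta> :: "'h \<Rightarrow> ('k, 'h, 'h) tensor" and \<epsilon> :: "'h \<Rightarrow> 'k" and S :: "'h \<Rightarrow> 'h"
    and \<rho> :: "'m \<Rightarrow> ('k, 'h, 'm) tensor"
    and \<alpha> :: "'wh \<Rightarrow> 'k"
  assumes "hopf_algebra (scal H) \<Delta> \<epsilon> S"
    and "differential_structure H"
    and "differentiable_to_tensor H H H \<Delta>"
    and "left_comodule_algebra (scal H) \<Delta> \<epsilon> (scal M) \<rho>"
    and "differential_structure M"
    and "differentiable_to_tensor M H M \<rho>"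
    and "\<alpha> \<in> braided_lie_algebra H \<epsilon>"
  shows "vector_field M (generated_field H M \<rho> \<alpha>) \<and>
    (\<forall>h. \<exists>y. exp_sums (scal H) (lie_derivative H (left_field H \<Delta> \<alpha>)) h y) \<and>
    linear_on (scal H) (*) UNIV (lie_exp H \<Delta> \<epsilon> \<alpha>) \<and>
    (\<forall>m. \<exists>y. exp_sums (scal M) (lie_derivative M (generated_field H M \<rho> \<alpha>)) m y) \<and>
    operator_exp (scal M) (lie_derivative M (generated_field H M \<rho> \<alpha>)) =
      tensor_lift (scal H) (scal M) (scal M) UNIV UNIV (\<lambda>h m. scal M (lie_exp H \<Delta> \<epsilon> \<alpha> h) m) \<circ> \<rho>"
proof -
  note hopf = assms(1)[unfolded hopf_algebra_def] and com = assms(4)[unfolded left_comodule_algebra_def]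
  have \<Delta>: "algebra_map_to_tensor (scal H) (scal H) (scal H) \<Delta>"
    and \<rho>: "algebra_map_to_tensor (scal M) (scal H) (scal M) \<rho>"
    and \<epsilon>: "linear_on (scal H) (*) UNIV \<epsilon>"
    and \<rho>_counit: "\<And>m. tensor_lift (scal H) (scal M) (scal M) UNIV UNIV (\<lambda>h n. scal M (\<epsilon> h) n) (\<rho> m) = m"
    using hopf com by blast+
  let ?a = "\<lambda>h. \<alpha> (diff H (emb H h))"
  interpret normed_left_comodule "scal H" \<Delta> \<epsilon> "scal M" \<rho> ?a
    by (intro normed_left_comodule.intro left_comodule.intro coalgebra.intro left_comodule_axioms.intro
        normed_left_comodule_axioms.intro)
      (use hopf com algebra_map_to_tensorD[OF \<Delta>] algebra_map_to_tensorD[OF \<rho>]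
        unital_algebraD(1)[OF ds_scal[OF assms(2)]] unital_algebraD(1)[OF ds_scal[OF assms(5)]]
        linear_braided_lie_algebra(2)[OF assms(2,7)] in blast)+
  have L: "lie_derivative H (left_field H \<Delta> \<alpha>) = invariant_op ?a"
    by (simp add: fun_eq_iff invariant_op_def lie_derivative_left_field[OF assms(2,3,7) \<Delta>])
  have D: "lie_derivative M (generated_field H M \<rho> \<alpha>) = coaction_op ?a"
    by (simp add: fun_eq_iff coaction_op_def lie_derivative_generated_field[OF assms(2,5,6,7) \<rho>])
  have E: "lie_exp H \<Delta> \<epsilon> \<alpha> = exp_functional"
    by (simp add: fun_eq_iff lie_exp_def exp_functional_def L)
  show ?thesis
    unfolding L D E
    using vector_field_generated_field[OF assms(2,5,6,7) \<rho> \<epsilon> \<rho>_counit]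
      exp_invariant_op_ex linear_exp_functional exp_coaction_op_ex
    by (simp add: fun_eq_iff exp_coaction_op coaction_op_def)
qed

end
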